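(* Let $p\in[1,\infty]$ and $\epsilon\in(0,1)$. For any stable, homotopy invariant distance $d$ on $\mathbb{R}$-spaces and any finite $P\subset\mathbb{R}^n$, $$d(S^\epsilon(P)\circ\exp,\ \check{\mathcal{C}}(P)\circ\exp)\le\log(1+\epsilon),$$ where $\check{\mathcal{C}}(P)$ is the Čech filtration of $P$ (with respect to the $\ell^p$-norm), $S^\epsilon(P)$ is the sparse filtration of $P$ (constructed from any greedy permutation of $P$), $\exp\colon\mathbb{R}\to(0,\infty)$ is the map $x\mapsto 2^x$, and $\log=\log_2$ is its inverse.
   Context: $\mathbf{Top}$ is the category of compactly generated weakly Hausdorff (CGWH) spaces and continuous maps; all topological constructions are carried out in it. Totally ordered sets are regarded as categories. An $\mathbb{R}$-space is a functor $\mathbb{R}\to\mathbf{Top}$; morphisms are natural transformations. Abstract simplicial complexes are regarded as spaces via geometric realization. A distance on $\mathbb{R}$-spaces is an extended pseudometric on the class of $\mathbb{R}$-spaces (symmetric, values in $[0,\infty]$, triangle inequality, $d(X,X)=0$). For $T\in\mathbf{Top}$ and a (not necessarily continuous) function $\gamma\colon T\to\mathbb{R}$, $\mathcal{S}(\gamma)$ is the $\mathbb{R}$-space $\mathcal{S}(\gamma)_r=\gamma^{-1}(-\infty,r]$ with the subspace topology (in the CGWH sense, i.e. the k-ification of the usual subspace topology) and internal maps the inclusions; $d_\infty(\gamma,\kappa)=\sup_{x\in T}|\gamma(x)-\kappa(x)|$. A natural transformation $f\colon X\to Y$ of $\mathbb{R}$-spaces is an (objectwise) weak equivalence if each $f_r$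 is a weak homotopy equivalence; $X\simeq Y$ means that $X$ and $Y$ are connected by a finite zigzag of objectwise weak equivalences. $d$ is stable if $d(\mathcal{S}(\gamma),\mathcal{S}(\kappa))\le d_\infty(\gamma,\kappa)$ for every $T\in\mathbf{Top}$ and all functions $\gamma,\kappa\colon T\to\mathbb{R}$; it is homotopy invariant if $d(X,Y)=0$ whenever $X\simeq Y$. Nerves: given a family $U=\{U^s\colon[0,\infty)\to\mathbf{Top}\}_{s\in S}$ of filtrations by subspaces of a fixed Euclidean space, $\mathrm{Ner}(U)$ is the functor from $[0,\infty)$ to simplicial complexes such that $\mathrm{Ner}(U)_r$ is the nerve of $\{U^s_r\}_{s\in S}$, i.e. its simplices are the finite nonempty $\sigma\subset S$ with $\bigcap_{s\in\sigma}U^s_r\ne\emptyset$; internal maps are inclusions. Čech filtration: for $x\in\mathbb{R}^n$ and $r\in\mathbb{R}$ let $B(x,r)=\{y\in\mathbb{R}^n\mid\|x-y\|_p\le r\}$. The Čech filtration $\check{\mathcal{C}}(P)$ of $P\subset\mathbb{R}^n$ is $\mathrm{Ner}(\{r\mapsto B(x,r)\}_{x\in P})$, a functor on $[0,\infty)$. Sparse filtration: let $P=\{p_1,\dots,p_m\}\subset\mathbb{R}^n$ be finite, with the ordering chosen to be a greedy permutation, i.e. for all $i\ge2$, $p_i$ is a point of $P$ furthest from $\{p_1,\dots,p_{i-1}\}$ in the $\ell^p$-metric $d_P$. Put $\lambda_1=\infty$ and $\lambda_i=\min_{j<i}d_P(p_i,p_j)$ for $i\in\{2,\dots,m\}$.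 For $r\in[0,\infty)$ let $$b_i(r)=\begin{cases}B(p_i,r)&\text{if }0\le r\le\lambda_i(1+\epsilon)/\epsilon,\\ B(p_i,\lambda_i(1+\epsilon)/\epsilon)&\text{if }\lambda_i(1+\epsilon)/\epsilon\le r\le\lambda_i(1+\epsilon)^2/\epsilon,\\ \emptyset&\text{otherwise,}\end{cases}\qquad U^i_r=\bigcup_{0\le q\le r}b_i(q)\times\{q\}\subset\mathbb{R}^{n+1}.$$ The spaces $U^i_r$ form a filtration $U^i$ indexed by $[0,\infty)$; set $U=\{U^i\}_{i\in\{1,\dots,m\}}$ and $S^\epsilon(P)=\mathrm{Ner}(U)$. *)

theory Defs
  imports "HOL-Analysis.Analysis"
begin

section \<open>Compactly generated weakly Hausdorff spaces\<close>

text \<open>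
  The category Top is taken relative to a universe: its objects are topologies whose points are
  elements of a type 'a. The compact Hausdorff test spaces are taken over the larger type
  'a set set, so that bounding their size loses nothing. Given a continuous u from an
  arbitrary compact Hausdorff space K to X, choose one preimage of every point of u(K); the
  closure of these choices is a compact Hausdorff space with at most 2^(2^card X) points
  (finitely many, if X is finite) and with the same image. This settles the weak Hausdorff
  property; and in a weakly Hausdorff space a set A has closed preimage under u if and only if
  it has closed preimage under this restriction of u.

  The library's k_space and kification test against all compact subsets,
  Hausdorff or not, which is in general a different notion.
\<close>

definition probe :: "'a set set topology \<Rightarrow> ('a set set \<Rightarrow> 'a) \<Rightarrow> 'a topology \<Rightarrow> bool" where
  "probe K u X \<longleftrightarrow> compact_space K \<and> Hausdorff_space K \<and> continuous_map K X u"

definition compactly_generated :: "'a topology \<Rightarrow> bool" where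
  "compactly_generated X \<longleftrightarrow>
     (\<forall>A \<subseteq> topspace X.
        (\<forall>K u. probe K u X \<longrightarrow> closedin K {z \<in> topspace K. u z \<in> A}) \<longrightarrow> closedin X A)"

definition weakly_Hausdorff :: "'a topology \<Rightarrow> bool" where
  "weakly_Hausdorff X \<longleftrightarrow> (\<forall>K u. probe K u X \<longrightarrow> closedin X (u ` topspace K))"

definition cgwh :: "'a topology \<Rightarrow> bool" where
  "cgwh X \<longleftrightarrow> compactly_generated X \<and> weakly_Hausdorff X"

definition kify :: "'a topology \<Rightarrow> 'a topology" where
  "kify X = topology (\<lambda>U. U \<subseteq> topspace X \<and>
     (\<forall>K u. probe K u X \<longrightarrow> openin K {z \<in> topspace K. u z \<in> U}))"

lemma openin_kify:
  "openin (kify X) U \<longleftrightarrow>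
     U \<subseteq> topspace X \<and> (\<forall>K u. probe K u X \<longrightarrow> openin K {z \<in> topspace K. u z \<in> U})"
proof -
  let ?P = "\<lambda>U. U \<subseteq> topspace X \<and>
     (\<forall>K u. probe K u X \<longrightarrow> openin K {z \<in> topspace K. u z \<in> U})"
  have "istopology ?P"
    unfolding istopology_def
  proof (intro conjI allI impI)
    fix S T K u
    assume S: "?P S" and T: "?P T" and p: "probe K u X"
    have "{z \<in> topspace K. u z \<in> S \<inter> T}
        = {z \<in> topspace K. u z \<in> S} \<inter> {z \<in> topspace K. u z \<in> T}"
      by blast
    then show "openin K {z \<in> topspace K. u z \<in> S \<inter> T}"
      using S T p by (simp add: openin_Int)
  next
    fix \<K> K u
    assume *: "\<forall>S\<in>\<K>. ?P S" and p: "probe K u X"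
    have "{z \<in> topspace K. u z \<in> \<Union>\<K>} = (\<Union>S\<in>\<K>. {z \<in> topspace K. u z \<in> S})"
      by blast
    moreover have "openin K (\<Union>S\<in>\<K>. {z \<in> topspace K. u z \<in> S})"
      using * p by (intro openin_Union) auto
    ultimately show "openin K {z \<in> topspace K. u z \<in> \<Union>\<K>}"
      by simp
  qed auto
  then show ?thesis
    by (simp add: kify_def)
qed

section \<open>Weak homotopy equivalences\<close>

definition cube :: "nat \<Rightarrow> (nat \<Rightarrow> real) topology" where
  "cube n = product_topology (\<lambda>_. top_of_set {0..1}) {..<n}"

definition cube_boundary :: "nat \<Rightarrow> (nat \<Rightarrow> real) set" where
  "cube_boundary n = {t \<in> topspace (cube n). \<exists>i<n. t i = 0 \<or> t i = 1}"

definition based_homotopic ::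
    "nat \<Rightarrow> 'a topology \<Rightarrow> 'a \<Rightarrow> ((nat \<Rightarrow> real) \<Rightarrow> 'a) \<Rightarrow> ((nat \<Rightarrow> real) \<Rightarrow> 'a) \<Rightarrow> bool" where
  "based_homotopic n X x = homotopic_with (\<lambda>g. \<forall>t \<in> cube_boundary n. g t = x) (cube n) X"

definition homotopy_classes ::
    "nat \<Rightarrow> 'a topology \<Rightarrow> 'a \<Rightarrow> ((nat \<Rightarrow> real) \<Rightarrow> 'a) set set" where
  "homotopy_classes n X x =
     {g. continuous_map (cube n) X g \<and> (\<forall>t \<in> cube_boundary n. g t = x)}
       // {(g, h). based_homotopic n X x g h}"

text \<open>
  The set underlying the n-th homotopy group of X at x is homotopy_classes n X x. The group
  structure is not needed: the map induced by f is a homomorphism, hence an isomorphism as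
  soon as it is bijective.
\<close>

definition weak_homotopy_equivalence ::
    "'a topology \<Rightarrow> 'b topology \<Rightarrow> ('a \<Rightarrow> 'b) \<Rightarrow> bool" where
  "weak_homotopy_equivalence X Y f \<longleftrightarrow>
     continuous_map X Y f \<and>
     bij_betw (\<lambda>C. {y. \<exists>x\<in>C. path_component_of Y (f x) y})
       (path_components_of X) (path_components_of Y) \<and>
     (\<forall>n\<ge>1. \<forall>x \<in> topspace X.
        bij_betw (\<lambda>C. {h. \<exists>g\<in>C. based_homotopic n Y (f x) (f \<circ> g) h})
          (homotopy_classes n X x) (homotopy_classes n Y (f x)))"

section \<open>Spaces indexed by the reals\<close>

text \<open>Only the maps arr r s with r \<le> s, on the points of obj r, are meaningful.\<close>

record 'a rspace =
  obj :: "real \<Rightarrow> 'a topology"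
  arr :: "real \<Rightarrow> real \<Rightarrow> 'a \<Rightarrow> 'a"

definition is_rspace :: "'a rspace \<Rightarrow> bool" where
  "is_rspace X \<longleftrightarrow>
     (\<forall>r. cgwh (obj X r)) \<and>
     (\<forall>r s. r \<le> s \<longrightarrow> continuous_map (obj X r) (obj X s) (arr X r s)) \<and>
     (\<forall>r. \<forall>x \<in> topspace (obj X r). arr X r r x = x) \<and>
     (\<forall>r s t. r \<le> s \<longrightarrow> s \<le> t \<longrightarrow>
        (\<forall>x \<in> topspace (obj X r). arr X s t (arr X r s x) = arr X r t x))"

definition natural_map :: "'a rspace \<Rightarrow> 'b rspace \<Rightarrow> (real \<Rightarrow> 'a \<Rightarrow> 'b) \<Rightarrow> bool" where
  "natural_map X Y f \<longleftrightarrow>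
     (\<forall>r. continuous_map (obj X r) (obj Y r) (f r)) \<and>
     (\<forall>r s. r \<le> s \<longrightarrow>
        (\<forall>x \<in> topspace (obj X r). f s (arr X r s x) = arr Y r s (f r x)))"

definition rspace_isomorphic :: "'a rspace \<Rightarrow> 'b rspace \<Rightarrow> bool" where
  "rspace_isomorphic X Y \<longleftrightarrow>
     (\<exists>f. natural_map X Y f \<and> (\<forall>r. homeomorphic_map (obj X r) (obj Y r) (f r)))"

definition weakly_equivalent_step :: "'a rspace \<Rightarrow> 'a rspace \<Rightarrow> bool" where
  "weakly_equivalent_step X Y \<longleftrightarrow> is_rspace X \<and> is_rspace Y \<and>
     (\<exists>f. natural_map X Y f \<and> (\<forall>r. weak_homotopy_equivalence (obj X r) (obj Y r) (f r)))"

definition weakly_equivalent :: "'a rspace \<Rightarrow> 'a rspace \<Rightarrow> bool" where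
  "weakly_equivalent = equivclp weakly_equivalent_step"

definition sublevel_rspace :: "'a topology \<Rightarrow> ('a \<Rightarrow> real) \<Rightarrow> 'a rspace" where
  "sublevel_rspace T \<gamma> =
     \<lparr> obj = (\<lambda>r. kify (subtopology T {x \<in> topspace T. \<gamma> x \<le> r})), arr = (\<lambda>r s x. x) \<rparr>"

section \<open>Distances\<close>

definition rspace_distance :: "('a rspace \<Rightarrow> 'a rspace \<Rightarrow> ennreal) \<Rightarrow> bool" where
  "rspace_distance d \<longleftrightarrow>
     (\<forall>X. is_rspace X \<longrightarrow> d X X = 0) \<and>
     (\<forall>X Y. is_rspace X \<longrightarrow> is_rspace Y \<longrightarrow> d X Y = d Y X) \<and>
     (\<forall>X Y Z. is_rspace X \<longrightarrow> is_rspace Y \<longrightarrow> is_rspace Z \<longrightarrow> d X Z \<le> d X Y + d Y Z)"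

definition stable_distance :: "('a rspace \<Rightarrow> 'a rspace \<Rightarrow> ennreal) \<Rightarrow> bool" where
  "stable_distance d \<longleftrightarrow>
     (\<forall>T \<gamma> \<kappa>. cgwh T \<longrightarrow>
        d (sublevel_rspace T \<gamma>) (sublevel_rspace T \<kappa>)
          \<le> (SUP x\<in>topspace T. ennreal \<bar>\<gamma> x - \<kappa> x\<bar>))"

definition homotopy_invariant_distance :: "('a rspace \<Rightarrow> 'a rspace \<Rightarrow> ennreal) \<Rightarrow> bool" where
  "homotopy_invariant_distance d \<longleftrightarrow>
     (\<forall>X Y. is_rspace X \<longrightarrow> is_rspace Y \<longrightarrow> weakly_equivalent X Y \<longrightarrow> d X Y = 0)"

section \<open>Simplicial complexes, nerves and geometric realization\<close>

definition nerve :: "'s set \<Rightarrow> ('s \<Rightarrow> 'a set) \<Rightarrow> 's set set" where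
  "nerve S V = {\<sigma>. \<sigma> \<noteq> {} \<and> finite \<sigma> \<and> \<sigma> \<subseteq> S \<and> (\<Inter>s\<in>\<sigma>. V s) \<noteq> {}}"

definition closed_simplex :: "'v set \<Rightarrow> ('v \<Rightarrow> real) set" where
  "closed_simplex \<sigma> = {t. (\<forall>v. 0 \<le> t v) \<and> (\<forall>v. v \<notin> \<sigma> \<longrightarrow> t v = 0) \<and> sum t \<sigma> = 1}"

definition realization :: "'v set set \<Rightarrow> ('v \<Rightarrow> real) topology" where
  "realization \<K> = topology (\<lambda>U. U \<subseteq> \<Union>(closed_simplex ` \<K>) \<and>
     (\<forall>\<sigma>\<in>\<K>. openin (top_of_set (closed_simplex \<sigma>)) (U \<inter> closed_simplex \<sigma>)))"

lemma openin_realization: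
  "openin (realization \<K>) U \<longleftrightarrow> U \<subseteq> \<Union>(closed_simplex ` \<K>) \<and>
     (\<forall>\<sigma>\<in>\<K>. openin (top_of_set (closed_simplex \<sigma>)) (U \<inter> closed_simplex \<sigma>))"
proof -
  let ?P = "\<lambda>U. U \<subseteq> \<Union>(closed_simplex ` \<K>) \<and>
     (\<forall>\<sigma>\<in>\<K>. openin (top_of_set (closed_simplex \<sigma>)) (U \<inter> closed_simplex \<sigma>))"
  have "istopology ?P"
    unfolding istopology_def
  proof (intro conjI allI impI ballI)
    fix S T \<sigma>
    assume S: "?P S" and T: "?P T" and \<sigma>: "\<sigma> \<in> \<K>"
    have "S \<inter> T \<inter> closed_simplex \<sigma> = (S \<inter> closed_simplex \<sigma>) \<inter> (T \<inter> closed_simplex \<sigma>)"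
      by blast
    then show "openin (top_of_set (closed_simplex \<sigma>)) (S \<inter> T \<inter> closed_simplex \<sigma>)"
      using S T \<sigma> by (metis openin_Int)
  next
    fix \<U> \<sigma>
    assume *: "\<forall>S\<in>\<U>. ?P S" and \<sigma>: "\<sigma> \<in> \<K>"
    have "\<Union>\<U> \<inter> closed_simplex \<sigma> = (\<Union>S\<in>\<U>. S \<inter> closed_simplex \<sigma>)"
      by blast
    moreover have "openin (top_of_set (closed_simplex \<sigma>)) (\<Union>S\<in>\<U>. S \<inter> closed_simplex \<sigma>)"
      using * \<sigma> by (intro openin_Union) auto
    ultimately show "openin (top_of_set (closed_simplex \<sigma>)) (\<Union>\<U> \<inter> closed_simplex \<sigma>)"
      by simp
  qed auto
  then show ?thesis
    by (simp add: realization_def)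
qed

text \<open>For an increasing family of complexes; the internal maps are the inclusions.\<close>

definition realization_rspace :: "(real \<Rightarrow> 'v set set) \<Rightarrow> ('v \<Rightarrow> real) rspace" where
  "realization_rspace F = \<lparr> obj = (\<lambda>r. realization (F r)), arr = (\<lambda>r s t. t) \<rparr>"

text \<open>
  The points of a realization are barycentric coordinates, in the type 'v => real, which need
  not be the universe 'u on which a distance is given. A statement about the value of a distance
  on a realization is made for its isomorphic copies over 'u.
\<close>

section \<open>Cech and sparse filtrations\<close>

definition lp_norm :: "ereal \<Rightarrow> real ^ 'n \<Rightarrow> real" where
  "lp_norm p x =
     (if p = \<infinity> then (MAX i. \<bar>x $ i\<bar>)
      else (\<Sum>i\<in>UNIV. \<bar>x $ i\<bar> powr real_of_ereal p) powr (1 / real_of_ereal p))"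

definition lp_ball :: "ereal \<Rightarrow> real ^ 'n \<Rightarrow> ereal \<Rightarrow> (real ^ 'n) set" where
  "lp_ball p x r = {y. ereal (lp_norm p (x - y)) \<le> r}"

definition cech :: "ereal \<Rightarrow> (real ^ 'n) set \<Rightarrow> real \<Rightarrow> (real ^ 'n) set set" where
  "cech p P r = nerve P (\<lambda>x. lp_ball p x (ereal r))"

definition greedy_permutation ::
    "ereal \<Rightarrow> (real ^ 'n) set \<Rightarrow> nat \<Rightarrow> (nat \<Rightarrow> real ^ 'n) \<Rightarrow> bool" where
  "greedy_permutation p P m pt \<longleftrightarrow>
     bij_betw pt {1..m} P \<and>
     (\<forall>i\<in>{2..m}. \<forall>q\<in>P.
        (MIN j\<in>{1..<i}. lp_norm p (q - pt j)) \<le> (MIN j\<in>{1..<i}. lp_norm p (pt i - pt j)))"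

definition insertion_radius :: "ereal \<Rightarrow> (nat \<Rightarrow> real ^ 'n) \<Rightarrow> nat \<Rightarrow> ereal" where
  "insertion_radius p pt i =
     (if i = 1 then \<infinity> else ereal (MIN j\<in>{1..<i}. lp_norm p (pt i - pt j)))"

text \<open>
  With insertion radius infinity both thresholds are infinity and the first case always applies,
  so the ball of infinite radius never occurs.
\<close>

definition sparse_ball ::
    "ereal \<Rightarrow> real \<Rightarrow> (nat \<Rightarrow> real ^ 'n) \<Rightarrow> nat \<Rightarrow> real \<Rightarrow> (real ^ 'n) set" where
  "sparse_ball p \<epsilon> pt i r =
     (let \<rho> = insertion_radius p pt i * ereal ((1 + \<epsilon>) / \<epsilon>);
          \<rho>' = insertion_radius p pt i * ereal ((1 + \<epsilon>)\<^sup>2 / \<epsilon>)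
      in if 0 \<le> r \<and> ereal r \<le> \<rho> then lp_ball p (pt i) (ereal r)
         else if \<rho> \<le> ereal r \<and> ereal r \<le> \<rho>' then lp_ball p (pt i) \<rho>
         else {})"

definition sparse_cover ::
    "ereal \<Rightarrow> real \<Rightarrow> (nat \<Rightarrow> real ^ 'n) \<Rightarrow> nat \<Rightarrow> real \<Rightarrow> ((real ^ 'n) \<times> real) set" where
  "sparse_cover p \<epsilon> pt i r = (\<Union>q\<in>{0..r}. sparse_ball p \<epsilon> pt i q \<times> {q})"

definition sparse_filtration ::
    "ereal \<Rightarrow> real \<Rightarrow> nat \<Rightarrow> (nat \<Rightarrow> real ^ 'n) \<Rightarrow> real \<Rightarrow> nat set set" where
  "sparse_filtration p \<epsilon> m pt r = nerve {1..m} (\<lambda>i. sparse_cover p \<epsilon> pt i r)"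

end

theory Submission
  imports Defs
begin

text \<open>
  Write \<open>\<lambda>\<^sub>i\<close> for the insertion radii and \<open>\<rho>\<^sub>i = \<lambda>\<^sub>i (1 + \<epsilon>) / \<epsilon>\<close> for the radius at which the ball of the
  \<open>i\<close>-th point freezes, and let \<open>E\<^sub>r\<close> be the nerve of the balls of radius
  \<open>max (r / (1 + \<epsilon>)) (min r \<rho>\<^sub>i)\<close>. Then \<open>C\<^sub>r\<close>, the Cech complex, satisfies
  \<open>E\<^sub>r \<subseteq> C\<^sub>r \<subseteq> E\<^bsub>(1 + \<epsilon>) r\<^esub>\<close>, so both are sublevel filtrations, up to homotopy, of two functions on
  the product of a simplex with the line that differ by at most \<open>log (1 + \<epsilon>)\<close>; stability bounds their distance.

  The sparse complex \<open>S\<^sub>r\<close> is contained in \<open>E\<^sub>r\<close>, and the inclusion is a homotopy equivalence: in both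
  complexes every vertex whose ball has disappeared before \<open>r\<close> can be removed, because the greedy
  permutation provides another vertex that dominates it, and on the vertices that remain the two
  complexes agree. No nerve theorem is needed. The inclusion is natural in \<open>r\<close>, so homotopy
  invariance identifies \<open>S\<close> and \<open>E\<close>.

  The intermediate spaces have to live in the universe of the given distance. If \<open>P\<close> has two points,
  this universe contains an edge of the realized Cech complex, hence a copy of the continuum;
  otherwise \<open>E\<close> and \<open>C\<close> coincide.
\<close>

section \<open>Change of base point along a free homotopy\<close>

text \<open>The constants fit together as follows. A ball is frozen at \<open>r\<close> once
  \<open>\<lambda>\<^sub>i < r \<epsilon> / (1 + \<epsilon>)\<close>, so by the greedy order a
  frozen point has an unfrozen one within \<open>r \<epsilon> / (1 + \<epsilon>)\<close>, and a ball
  of radius \<open>r / (1 + \<epsilon>)\<close> about the former lies in the ball of radius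
  \<open>r\<close> about the latter. Hence the lower bound \<open>r / (1 + \<epsilon>)\<close> in
  \<open>E\<^sub>r\<close> is invisible to the vertices still present and leaves the others
  removable, while it limits the loss against \<open>C\<^sub>r\<close> to the factor
  \<open>1 + \<epsilon>\<close>.

  The obstacle on the topological side is that weak equivalences are defined through based maps of
  cubes, whereas the deformations that remove a vertex are free: they move the base point along a
  path, and based maps have to be carried back along it.\<close>

lemma topspace_cube: "topspace (cube n) = PiE {..<n} (\<lambda>_. {0..1})"
  by (simp add: cube_def)

lemma cube_boundary_subset: "s \<in> cube_boundary n \<Longrightarrow> s \<in> topspace (cube n)"
  by (simp add: cube_boundary_def)

lemma continuous_map_cube_coordinate:
  assumes "continuous_map Z (cube n) f" "i < n"
  shows "continuous_map Z euclideanreal (\<lambda>z. f z i)"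
  using assms unfolding cube_def continuous_map_componentwise by (auto simp: continuous_map_in_subtopology)

abbreviation unit_interval :: "real topology" where
  "unit_interval \<equiv> top_of_set {0..1}"

text \<open>Dilation of the cube about its centre followed by clamping. Points that leave the cube land on its
  boundary, where based maps are constant.\<close>

definition spread :: "nat \<Rightarrow> real \<Rightarrow> (nat \<Rightarrow> real) \<Rightarrow> nat \<Rightarrow> real" where
  "spread n a s = (\<lambda>i\<in>{..<n}. max 0 (min 1 ((1 + a) * s i - a / 2)))"

text \<open>The sup-norm distance to the centre, scaled so that the boundary of the cube is the
  level 1.\<close>

definition eccentricity :: "nat \<Rightarrow> (nat \<Rightarrow> real) \<Rightarrow> real" where
  "eccentricity n s = (MAX i\<in>{..<n}. \<bar>2 * s i - 1\<bar>)"

text \<open>The change of base point along \<open>\<omega>\<close>: a half-size copy of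
  \<open>\<alpha>\<close> sits in the middle, and the shell around it runs radially through
  \<open>\<omega>\<close>, from \<open>\<omega> 0\<close> at the inner cube to
  \<open>\<omega> 1\<close> at the boundary.\<close>

definition transport :: "nat \<Rightarrow> (real \<Rightarrow> 'a) \<Rightarrow> ((nat \<Rightarrow> real) \<Rightarrow> 'a) \<Rightarrow> (nat \<Rightarrow> real) \<Rightarrow> 'a" where
  "transport n \<omega> \<alpha> s =
     (if 2 * eccentricity n s \<le> 1 then \<alpha> (spread n 1 s) else \<omega> (2 * eccentricity n s - 1))"

lemma continuous_map_convex_unit:
  assumes "continuous_map Z euclideanreal g" "\<And>z. z \<in> topspace Z \<Longrightarrow> g z \<in> {0..1}"
  shows "continuous_map Z unit_interval g"
  using assms by (auto simp: continuous_map_in_subtopology)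

lemma continuous_map_spread:
  assumes "continuous_map Z euclideanreal a" "continuous_map Z (cube n) s"
  shows "continuous_map Z (cube n) (\<lambda>z. spread n (a z) (s z))"
proof -
  have "continuous_map Z unit_interval (\<lambda>z. spread n (a z) (s z) i)" if "i < n" for i
  proof (rule continuous_map_convex_unit)
    have "continuous_map Z euclideanreal (\<lambda>z. max 0 (min 1 ((1 + a z) * s z i - a z / 2)))"
      by (intro continuous_map_real_max continuous_map_real_min continuous_map_diff
          continuous_map_real_mult continuous_map_add continuous_map_real_divide continuous_map_cube_coordinate [OF assms(2) that] assms) auto
    then show "continuous_map Z euclideanreal (\<lambda>z. spread n (a z) (s z) i)"
      using that by (simp add: spread_def)
  qed (use that in \<open>auto simp: spread_def\<close>)
  then show ?thesis
    unfolding cube_def continuous_map_componentwise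
    by (auto simp: spread_def)
qed

lemma continuous_map_Max:
  assumes "finite I" "I \<noteq> {}" "\<And>i. i \<in> I \<Longrightarrow> continuous_map Z euclideanreal (\<lambda>z. f z i)"
  shows "continuous_map Z euclideanreal (\<lambda>z. MAX i\<in>I. f z i :: real)"
  using assms
proof (induction I rule: finite_ne_induct)
  case (insert i I)
  then show ?case
    by (auto intro!: continuous_map_real_max)
qed auto

lemma continuous_map_eccentricity:
  assumes "1 \<le> n" "continuous_map Z (cube n) s"
  shows "continuous_map Z euclideanreal (\<lambda>z. eccentricity n (s z))"
  unfolding eccentricity_def using assms
  by (intro continuous_map_Max continuous_map_real_abs continuous_map_diff continuous_map_real_mult
      continuous_map_canonical_const continuous_map_cube_coordinate [of Z n s]) (auto simp: lessThan_empty_iff)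

lemma eccentricity_le_iff:
  assumes "1 \<le> n"
  shows "eccentricity n s \<le> b \<longleftrightarrow> (\<forall>i<n. \<bar>2 * s i - 1\<bar> \<le> b)"
  using assms unfolding eccentricity_def by (subst Max_le_iff) (auto simp: lessThan_empty_iff)

lemma eccentricity_attained:
  assumes "1 \<le> n"
  obtains i where "i < n" "eccentricity n s = \<bar>2 * s i - 1\<bar>"
proof -
  have "eccentricity n s \<in> (\<lambda>i. \<bar>2 * s i - 1\<bar>) ` {..<n}"
    using assms unfolding eccentricity_def by (intro Max_in) (auto simp: lessThan_empty_iff)
  then show ?thesis using that by auto
qed

lemma eccentricity_le_1:
  assumes "1 \<le> n" "s \<in> topspace (cube n)"
  shows "eccentricity n s \<le> 1"
  using assms by (fastforce simp: eccentricity_le_iff topspace_cube PiE_iff abs_le_iff)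

lemma eccentricity_nonneg: "1 \<le> n \<Longrightarrow> 0 \<le> eccentricity n s"
  by (metis abs_ge_zero eccentricity_attained)

lemma eccentricity_boundary:
  assumes "s \<in> cube_boundary n"
  shows "eccentricity n s = 1"
proof -
  from assms obtain i where i: "i < n" "s i = 0 \<or> s i = 1" and s: "s \<in> topspace (cube n)"
    by (auto simp: cube_boundary_def)
  then have n: "1 \<le> n" by simp
  have "\<bar>2 * s i - 1\<bar> \<le> eccentricity n s"
    using i eccentricity_le_iff [OF n, of s "eccentricity n s"] by blast
  then show ?thesis using i eccentricity_le_1 [OF n s] by auto
qed

lemma spread_in_cube: "spread n a s \<in> topspace (cube n)"
  by (auto simp: spread_def topspace_cube)

lemma spread_0: "s \<in> topspace (cube n) \<Longrightarrow> spread n 0 s = s"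
  by (force simp: spread_def topspace_cube PiE_iff extensional_def restrict_def)

lemma spread_boundary:
  assumes "s \<in> cube_boundary n" "0 \<le> a"
  shows "spread n a s \<in> cube_boundary n"
proof -
  from assms obtain i where "i < n" "s i = 0 \<or> s i = 1"
    by (auto simp: cube_boundary_def)
  then have "i < n" "spread n a s i = 0 \<or> spread n a s i = 1"
    using assms(2) by (auto simp: spread_def min_def max_def field_simps)
  then show ?thesis
    using spread_in_cube by (auto simp: cube_boundary_def)
qed

lemma spread_outer:
  assumes "1 \<le> n" "0 \<le> a" "1 \<le> (1 + a) * eccentricity n s"
  shows "spread n a s \<in> cube_boundary n"
proof -
  obtain i where i: "i < n" "eccentricity n s = \<bar>2 * s i - 1\<bar>"
    using eccentricity_attained assms(1) by blast
  have "spread n a s i = 0 \<or> spread n a s i = 1"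
  proof (cases "0 \<le> 2 * s i - 1")
    case True
    then have "1 \<le> (1 + a) * s i - a / 2" using assms(3) i by (simp add: algebra_simps)
    then show ?thesis using i by (auto simp: spread_def)
  next
    case False
    then have "(1 + a) * s i - a / 2 \<le> 0" using assms(3) i by (simp add: algebra_simps)
    then show ?thesis using i by (auto simp: spread_def)
  qed
  then show ?thesis
    using spread_in_cube i by (auto simp: cube_boundary_def)
qed

lemma based_homotopicI:
  assumes "continuous_map (prod_topology unit_interval (cube n)) X h"
    and "\<And>s. s \<in> topspace (cube n) \<Longrightarrow> h (0, s) = f s"
    and "\<And>s. s \<in> topspace (cube n) \<Longrightarrow> h (1, s) = g s"
    and "\<And>t s. t \<in> {0..1} \<Longrightarrow> s \<in> cube_boundary n \<Longrightarrow> h (t, s) = x"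
  shows "based_homotopic n X x f g"
  unfolding based_homotopic_def
\<comment> \<open>The boundary condition only looks at points of the cube, so the ends of the
  homotopy need to match \<open>f\<close> and \<open>g\<close> only there.\<close>
proof (subst homotopic_with, goal_cases)
  case (1 h k)
  then show ?case using cube_boundary_subset by auto
qed (use assms in blast)

lemma based_homotopic_sym: "based_homotopic n X x f g \<Longrightarrow> based_homotopic n X x g f"
  unfolding based_homotopic_def by (rule homotopic_with_symD)

lemma based_homotopic_trans:
  "based_homotopic n X x f g \<Longrightarrow> based_homotopic n X x g h \<Longrightarrow> based_homotopic n X x f h"
  unfolding based_homotopic_def by (rule homotopic_with_trans)

lemma based_homotopic_imp:
  assumes "based_homotopic n X x f g"
  shows "continuous_map (cube n) X f" "continuous_map (cube n) X g"
    "s \<in> cube_boundary n \<Longrightarrow> f s = x" "s \<in> cube_boundary n \<Longrightarrow> g s = x"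
  using assms homotopic_with_imp_continuous_maps homotopic_with_imp_property
  unfolding based_homotopic_def by blast+

lemma based_homotopic_compose:
  assumes "based_homotopic n X x f g" "continuous_map X Y \<phi>"
  shows "based_homotopic n Y (\<phi> x) (\<phi> \<circ> f) (\<phi> \<circ> g)"
  using assms unfolding based_homotopic_def
  by (rule homotopic_with_compose_continuous_map_left) auto

lemma continuous_map_prod_fst_real:
  "continuous_map (prod_topology unit_interval Z) euclideanreal fst"
  using continuous_map_fst continuous_map_in_subtopology by blast

text \<open>\<open>transport\<close> depends only on the start and on the track of the boundary, so two free
  homotopies that agree in both end in based homotopic maps.\<close>

lemma based_homotopic_transport:
  assumes n: "1 \<le> n"
    and F: "continuous_map (prod_topology unit_interval (cube n)) X F"
    and b: "\<And>u s. u \<in> {0..1} \<Longrightarrow> s \<in> cube_boundary n \<Longrightarrow> F (u, s) = \<omega> u"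
  shows "based_homotopic n X (\<omega> 1) (\<lambda>s. F (1, s)) (transport n \<omega> (\<lambda>s. F (0, s)))"
proof (rule based_homotopic_trans)
  let ?Z = "prod_topology unit_interval (cube n)"
  show "based_homotopic n X (\<omega> 1) (\<lambda>s. F (1, s)) (\<lambda>s. F (1, spread n 1 s))"
  proof (rule based_homotopicI)
    show "continuous_map ?Z X (\<lambda>z. F (1, spread n (fst z) (snd z)))"
      by (intro continuous_map_compose [OF _ F, unfolded o_def] continuous_map_pairedI
          continuous_map_spread continuous_map_prod_fst_real continuous_map_snd) auto
  qed (auto simp: spread_0 b spread_boundary)
  \<comment> \<open>The time at which \<open>F\<close> is read: 0 on the inner half-size cube and
    growing to 1 at the boundary. In the shell the dilated point lies on the boundary, where reading
    \<open>F\<close> at this time gives the value of \<omega> required by \<open>transport\<close>.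
    Pushing the time up to 1 everywhere is the homotopy.\<close>
  let ?e = "\<lambda>s. max 0 (2 * eccentricity n s - 1)"
  have e01: "0 \<le> ?e s" "?e s \<le> 1" if "s \<in> topspace (cube n)" for s
    using eccentricity_le_1 [OF n that] by auto
  show "based_homotopic n X (\<omega> 1) (\<lambda>s. F (1, spread n 1 s)) (transport n \<omega> (\<lambda>s. F (0, s)))"
  proof (rule based_homotopic_sym, rule based_homotopicI)
    show "continuous_map ?Z X (\<lambda>z. F (fst z + (1 - fst z) * ?e (snd z), spread n 1 (snd z)))"
    proof (intro continuous_map_compose [OF _ F, unfolded o_def] continuous_map_pairedI
          continuous_map_spread continuous_map_snd continuous_map_convex_unit)
      show "continuous_map ?Z euclideanreal (\<lambda>z. fst z + (1 - fst z) * ?e (snd z))"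
        by (intro continuous_intros continuous_map_prod_fst_real continuous_map_real_max
            continuous_map_eccentricity n continuous_map_snd)
      fix z assume z: "z \<in> topspace ?Z"
      then have "0 \<le> fst z" "fst z \<le> 1" "snd z \<in> topspace (cube n)" by auto
      then show "fst z + (1 - fst z) * ?e (snd z) \<in> {0..1}"
        using e01 [of "snd z"] mult_left_mono [of "?e (snd z)" 1 "1 - fst z"] by auto
    qed auto
  next
    fix s assume s: "s \<in> topspace (cube n)"
    show "F (fst (0, s) + (1 - fst (0, s)) * ?e (snd (0::real, s)), spread n 1 (snd (0::real, s)))
        = transport n \<omega> (\<lambda>s. F (0, s)) s"
    proof (cases "2 * eccentricity n s \<le> 1")
      case False
      then show ?thesis
        using e01 [OF s] spread_outer [OF n, of 1 s] by (simp add: transport_def b)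
    qed (auto simp: transport_def)
  qed (auto simp: b eccentricity_boundary spread_boundary)
qed

text \<open>The parameter \<open>a\<close> covers both uses: the constant 1 for
  \<open>transport\<close> itself, and the time coordinate for the deformation into it. The two
  branches meet where the dilated point reaches the boundary.\<close>

lemma continuous_map_outer_glue:
  assumes n: "1 \<le> n" and k: "continuous_map Z X k" and a: "continuous_map Z euclideanreal a"
    and s: "continuous_map Z (cube n) s" and \<omega>: "continuous_map unit_interval X \<omega>"
    and a01: "\<And>z. z \<in> topspace Z \<Longrightarrow> a z \<in> {0..1}"
    and eq: "\<And>z. z \<in> topspace Z \<Longrightarrow> (1 + a z) * eccentricity n (s z) = 1 \<Longrightarrow> k z = \<omega> 0"
  shows "continuous_map Z X (\<lambda>z. if (1 + a z) * eccentricity n (s z) \<le> 1 then k z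
           else \<omega> ((1 + a z) * eccentricity n (s z) - 1))"
proof (rule continuous_map_cases_le)
  show c: "continuous_map Z euclideanreal (\<lambda>z. (1 + a z) * eccentricity n (s z))"
    by (intro continuous_intros a continuous_map_eccentricity n s)
  show "continuous_map (subtopology Z {z \<in> topspace Z. 1 \<le> (1 + a z) * eccentricity n (s z)}) X
     (\<lambda>z. \<omega> ((1 + a z) * eccentricity n (s z) - 1))"
  proof (rule continuous_map_compose [OF _ \<omega>, unfolded o_def], rule continuous_map_convex_unit)
    fix z assume z: "z \<in> topspace (subtopology Z {z \<in> topspace Z. 1 \<le> (1 + a z) * eccentricity n (s z)})"
    then have "s z \<in> topspace (cube n)" "a z \<in> {0..1}"
      using s a01 by (auto simp: continuous_map_def)
    then have "eccentricity n (s z) \<le> 1" "a z \<in> {0..1}"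
      using eccentricity_le_1 n by blast+
    then have "(1 + a z) * eccentricity n (s z) \<le> 2 * 1"
      by (intro mult_mono eccentricity_nonneg n) auto
    then show "(1 + a z) * eccentricity n (s z) - 1 \<in> {0..1}" using z by auto
  qed (intro continuous_intros continuous_map_from_subtopology c)
qed (use eq in \<open>auto intro: continuous_map_from_subtopology k\<close>)

lemma based_homotopic_transport_cong:
  assumes n: "1 \<le> n" and \<omega>: "continuous_map unit_interval X \<omega>"
    and h: "based_homotopic n X (\<omega> 0) \<alpha> \<beta>"
  shows "based_homotopic n X (\<omega> 1) (transport n \<omega> \<alpha>) (transport n \<omega> \<beta>)"
proof -
  let ?Z = "prod_topology unit_interval (cube n)"
  obtain K where K: "continuous_map ?Z X K" "\<And>s. K (0, s) = \<alpha> s" "\<And>s. K (1, s) = \<beta> s"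
    and Kb: "\<And>t s. t \<in> {0..1} \<Longrightarrow> s \<in> cube_boundary n \<Longrightarrow> K (t, s) = \<omega> 0"
    using h unfolding based_homotopic_def homotopic_with_def by blast
  let ?h = "\<lambda>z. if (1 + 1) * eccentricity n (snd z) \<le> 1 then K (fst z, spread n 1 (snd z))
           else \<omega> ((1 + 1) * eccentricity n (snd z) - 1)"
  show ?thesis
  proof (rule based_homotopicI)
    show "continuous_map ?Z X ?h"
    proof (rule continuous_map_outer_glue [OF n _ _ _ \<omega>])
      show "continuous_map ?Z X (\<lambda>z. K (fst z, spread n 1 (snd z)))"
        by (intro continuous_map_compose [OF _ K(1), unfolded o_def] continuous_map_pairedI
          continuous_map_spread continuous_map_fst continuous_map_snd) auto
      show "K (fst z, spread n 1 (snd z)) = \<omega> 0"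
        if "z \<in> topspace ?Z" "(1 + 1) * eccentricity n (snd z) = 1" for z
        using that by (intro Kb spread_outer n) auto
    qed (auto simp: continuous_map_snd)
  qed (auto simp: transport_def K eccentricity_boundary)
qed

text \<open>Homotopy extension for the cube and its boundary, made explicit: at time
  \<open>u\<close> the map \<open>\<alpha>\<close> occupies the cube shrunk by the factor
  \<open>1 + u\<close>, and the shell around it follows \<open>\<omega>\<close> up to
  \<open>\<omega> u\<close>.\<close>

lemma transport_homotopy:
  assumes n: "1 \<le> n" and \<omega>: "continuous_map unit_interval X \<omega>"
    and \<alpha>: "continuous_map (cube n) X \<alpha>" "\<And>s. s \<in> cube_boundary n \<Longrightarrow> \<alpha> s = \<omega> 0"
  obtains F where "continuous_map (prod_topology unit_interval (cube n)) X F"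
    "\<And>s. s \<in> topspace (cube n) \<Longrightarrow> F (0, s) = \<alpha> s" "\<And>s. F (1, s) = transport n \<omega> \<alpha> s"
    "\<And>u s. u \<in> {0..1} \<Longrightarrow> s \<in> cube_boundary n \<Longrightarrow> F (u, s) = \<omega> u"
proof
  let ?Z = "prod_topology unit_interval (cube n)"
  let ?F = "\<lambda>z. if (1 + fst z) * eccentricity n (snd z) \<le> 1 then \<alpha> (spread n (fst z) (snd z))
           else \<omega> ((1 + fst z) * eccentricity n (snd z) - 1)"
  show "continuous_map ?Z X ?F"
  proof (rule continuous_map_outer_glue [OF n _ _ _ \<omega>])
    show "continuous_map ?Z X (\<lambda>z. \<alpha> (spread n (fst z) (snd z)))"
      by (intro continuous_map_compose [OF _ \<alpha>(1), unfolded o_def]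
          continuous_map_spread continuous_map_prod_fst_real continuous_map_snd)
    show "\<alpha> (spread n (fst z) (snd z)) = \<omega> 0"
      if "z \<in> topspace ?Z" "(1 + fst z) * eccentricity n (snd z) = 1" for z
      using that by (intro \<alpha>(2) spread_outer n) auto
  qed (auto simp: continuous_map_snd continuous_map_prod_fst_real)
  show "?F (0, s) = \<alpha> s" if "s \<in> topspace (cube n)" for s
    using eccentricity_le_1 [OF n that] that by (simp add: spread_0)
  show "?F (u, s) = \<omega> u" if "u \<in> {0..1}" "s \<in> cube_boundary n" for u s
    using that \<alpha>(2) [of "spread n u s"] by (auto simp: eccentricity_boundary spread_boundary)
qed (auto simp: transport_def)

section \<open>Homotopy equivalences are weak equivalences\<close>

definition based_maps :: "nat \<Rightarrow> 'a topology \<Rightarrow> 'a \<Rightarrow> ((nat \<Rightarrow> real) \<Rightarrow> 'a) set" where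
  "based_maps n X x = {g. continuous_map (cube n) X g \<and> (\<forall>s \<in> cube_boundary n. g s = x)}"

text \<open>Injectivity on homotopy groups. The homotopy moves \<open>\<phi> x\<close> to
  \<open>x\<close> along a path, and transport along this path undoes \<open>\<phi>\<close> on based
  maps up to based homotopy; transport also respects based homotopies.\<close>

lemma homotopic_to_id_reflects_based_homotopic:
  assumes n: "1 \<le> n" and h: "homotopic_with (\<lambda>_. True) X X id \<phi>" and x: "x \<in> topspace X"
    and \<alpha>: "\<alpha> \<in> based_maps n X x" and \<beta>: "\<beta> \<in> based_maps n X x"
    and c: "based_homotopic n X (\<phi> x) (\<phi> \<circ> \<alpha>) (\<phi> \<circ> \<beta>)"
  shows "based_homotopic n X x \<alpha> \<beta>"
proof -
  obtain H where H: "continuous_map (prod_topology unit_interval X) X H"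
      "\<And>y. H (0, y) = \<phi> y" "\<And>y. H (1, y) = y"
    using homotopic_with_symD [OF h] unfolding homotopic_with_def by auto
  define \<omega> where "\<omega> = (\<lambda>u. H (u, x))"
  have \<omega>: "continuous_map unit_interval X \<omega>"
    unfolding \<omega>_def
    by (intro continuous_map_compose [OF _ H(1), unfolded o_def] continuous_map_pairedI) (auto simp: x)
  have *: "based_homotopic n X x \<gamma> (transport n \<omega> (\<phi> \<circ> \<gamma>))"
    if "\<gamma> \<in> based_maps n X x" for \<gamma>
  proof -
    have \<gamma>: "continuous_map (cube n) X \<gamma>" "\<And>s. s \<in> cube_boundary n \<Longrightarrow> \<gamma> s = x"
      using that by (auto simp: based_maps_def)
    let ?F = "\<lambda>z. H (fst z, \<gamma> (snd z))"
    have "continuous_map (prod_topology unit_interval (cube n)) X ?F"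
      by (intro continuous_map_compose [OF _ H(1), unfolded o_def] continuous_map_pairedI
          continuous_map_compose [OF _ \<gamma>(1), unfolded o_def] continuous_map_fst continuous_map_snd) 
    from based_homotopic_transport [OF n this, of \<omega>] \<gamma>(2)
    show ?thesis by (simp add: \<omega>_def H o_def)
  qed
  have "based_homotopic n X x (transport n \<omega> (\<phi> \<circ> \<alpha>)) (transport n \<omega> (\<phi> \<circ> \<beta>))"
    using based_homotopic_transport_cong [OF n \<omega>, of "\<phi> \<circ> \<alpha>" "\<phi> \<circ> \<beta>"] c by (simp add: \<omega>_def H)
  then show ?thesis
    using * [OF \<alpha>] * [OF \<beta>] based_homotopic_sym based_homotopic_trans by metis
qed

text \<open>Surjectivity on homotopy groups. The lift is \<open>\<beta>\<close> transported back
  along the reversed track of \<open>x\<close>; both \<open>\<phi> \<circ> \<alpha>\<close> and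
  \<open>\<beta>\<close> are then based homotopic to the transport of \<open>\<alpha>\<close> along
  the forward track.\<close>

lemma homotopic_to_id_lifts_based_map:
  assumes n: "1 \<le> n" and h: "homotopic_with (\<lambda>_. True) X X id \<phi>" and x: "x \<in> topspace X"
    and "\<beta> \<in> based_maps n X (\<phi> x)"
  obtains \<alpha> where "\<alpha> \<in> based_maps n X x" "based_homotopic n X (\<phi> x) (\<phi> \<circ> \<alpha>) \<beta>"
proof -
  have \<beta>: "continuous_map (cube n) X \<beta>" "\<And>s. s \<in> cube_boundary n \<Longrightarrow> \<beta> s = \<phi> x"
    using assms(4) by (auto simp: based_maps_def)
  let ?Z = "prod_topology unit_interval (cube n)"
  obtain H where H: "continuous_map (prod_topology unit_interval X) X H"
      "\<And>y. H (0, y) = y" "\<And>y. H (1, y) = \<phi> y"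
    using h unfolding homotopic_with_def by auto
  define \<omega> where "\<omega> = (\<lambda>u. H (u, x))"
  define \<omega>' where "\<omega>' = (\<lambda>u. H (1 - u, x))"
  have rev: "continuous_map unit_interval unit_interval (\<lambda>u. 1 - u)"
    by (auto simp: continuous_map_in_subtopology intro!: continuous_intros)
  have \<omega>': "continuous_map unit_interval X \<omega>'"
    unfolding \<omega>'_def
    by (intro continuous_map_compose [OF _ H(1), unfolded o_def] continuous_map_pairedI rev) (auto simp: x)
  have b: "\<beta> s = \<omega>' 0" if "s \<in> cube_boundary n" for s
    using \<beta>(2) [OF that] by (simp add: \<omega>'_def H)
  obtain F where F: "continuous_map ?Z X F"
    "\<And>s. s \<in> topspace (cube n) \<Longrightarrow> F (0, s) = \<beta> s" "\<And>s. F (1, s) = transport n \<omega>' \<beta> s"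
    "\<And>u s. u \<in> {0..1} \<Longrightarrow> s \<in> cube_boundary n \<Longrightarrow> F (u, s) = \<omega>' u"
    using transport_homotopy [OF n \<omega>' \<beta>(1) b] by blast
  define \<alpha> where "\<alpha> = transport n \<omega>' \<beta>"
  have \<alpha>: "continuous_map (cube n) X \<alpha>"
    using continuous_map_compose [OF _ F(1), of "cube n" "\<lambda>s. (1, s)"]
    by (simp add: o_def F \<alpha>_def continuous_map_pairedI)
  have \<alpha>x: "\<alpha> s = x" if "s \<in> cube_boundary n" for s
    using F(4) [OF _ that, of 1] by (simp add: F(3) \<alpha>_def \<omega>'_def H)
  have "continuous_map ?Z X (\<lambda>z. F (1 - fst z, snd z))"
    by (intro continuous_map_compose [OF _ F(1), unfolded o_def] continuous_map_pairedI
        continuous_map_compose [OF _ rev, unfolded o_def] continuous_map_fst continuous_map_snd)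
  from based_homotopic_transport [OF n this, of \<omega>]
  have "based_homotopic n X (\<omega> 1) (\<lambda>s. F (0, s)) (transport n \<omega> (\<lambda>s. F (1, s)))"
    by (simp add: F(4) \<omega>_def \<omega>'_def)
  then have 1: "based_homotopic n X (\<phi> x) (\<lambda>s. F (0, s)) (transport n \<omega> \<alpha>)"
    by (simp add: F(3) \<alpha>_def \<omega>_def H)
  \<comment> \<open>\<open>F (0, s)\<close> and \<open>\<beta> s\<close> are known to agree only at
    points of the cube, so a constant homotopy stands in for an equality of functions.\<close>
  have "based_homotopic n X (\<phi> x) \<beta> (\<lambda>s. F (0, s))"
    by (rule based_homotopicI [where h = "\<lambda>z. \<beta> (snd z)"])
      (auto simp: F(2) \<beta>(2) intro!: continuous_map_compose [OF _ \<beta>(1), unfolded o_def] continuous_map_snd)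
  moreover have "continuous_map ?Z X (\<lambda>z. H (fst z, \<alpha> (snd z)))"
    by (intro continuous_map_compose [OF _ H(1), unfolded o_def] continuous_map_pairedI
        continuous_map_compose [OF _ \<alpha>, unfolded o_def] continuous_map_fst continuous_map_snd)
  from based_homotopic_transport [OF n this, of \<omega>]
  have "based_homotopic n X (\<omega> 1) (\<lambda>s. H (1, \<alpha> s)) (transport n \<omega> (\<lambda>s. H (0, \<alpha> s)))"
    by (simp add: \<alpha>x \<omega>_def)
  then have "based_homotopic n X (\<phi> x) (\<phi> \<circ> \<alpha>) (transport n \<omega> \<alpha>)"
    by (simp add: H \<omega>_def o_def)
  ultimately have "based_homotopic n X (\<phi> x) (\<phi> \<circ> \<alpha>) \<beta>"
    using 1 based_homotopic_sym based_homotopic_trans by metis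
  moreover have "\<alpha> \<in> based_maps n X x" using \<alpha> \<alpha>x by (simp add: based_maps_def)
  ultimately show ?thesis using that by blast
qed

text \<open>The form is that of the induced maps in \<open>weak_homotopy_equivalence\<close>, which
  send a class to the saturation of its image. It serves both path components and homotopy
  groups.\<close>

lemma bij_betw_quotient:
  assumes R: "equiv A R" and S: "equiv B S" and F: "\<And>a. a \<in> A \<Longrightarrow> F a \<in> B"
    and iff: "\<And>a b. a \<in> A \<Longrightarrow> b \<in> A \<Longrightarrow> (F a, F b) \<in> S \<longleftrightarrow> (a, b) \<in> R"
    and surj: "\<And>b. b \<in> B \<Longrightarrow> \<exists>a\<in>A. (F a, b) \<in> S"
  shows "bij_betw (\<lambda>C. S `` (F ` C)) (A // R) (B // S)"
proof -
  have cls: "S `` (F ` (R `` {a})) = S `` {F a}" if "a \<in> A" for a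
  proof
    have "b \<in> A \<and> (F a, F b) \<in> S" if "(a, b) \<in> R" for b
      using that iff \<open>a \<in> A\<close> R by (auto simp: equiv_def)
    then show "S `` (F ` (R `` {a})) \<subseteq> S `` {F a}"
      using S by (auto simp: equiv_def dest: transD)
    show "S `` {F a} \<subseteq> S `` (F ` (R `` {a}))"
      using equiv_class_self [OF R that] by blast
  qed
  show ?thesis
  proof (rule bij_betw_imageI)
    show "inj_on (\<lambda>C. S `` (F ` C)) (A // R)"
    proof (rule inj_onI, elim quotientE)
      fix C D a b assume *: "S `` (F ` C) = S `` (F ` D)" "a \<in> A" "C = R `` {a}" "b \<in> A" "D = R `` {b}"
      then have "S `` {F a} = S `` {F b}" by (simp add: cls)
      then have "(F a, F b) \<in> S" by (rule eq_equiv_class [OF _ S F [OF *(4)]])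
      then have "(a, b) \<in> R" using *(2,4) iff by blast
      then show "C = D" unfolding *(3,5) by (rule equiv_class_eq [OF R])
    qed
    have "S `` {b} \<in> (\<lambda>C. S `` (F ` C)) ` (A // R)" if b: "b \<in> B" for b
    proof -
      obtain a where a: "a \<in> A" "(F a, b) \<in> S" using surj b by blast
      then have "S `` {b} = S `` (F ` (R `` {a}))" using cls equiv_class_eq [OF S] by metis
      then show ?thesis by (rule image_eqI) (rule quotientI [OF a(1)])
    qed
    then have "B // S \<subseteq> (\<lambda>C. S `` (F ` C)) ` (A // R)"
      by (auto simp only: quotient_def [of B])
    moreover have "S `` (F ` C) \<in> B // S" if "C \<in> A // R" for C
      using that by (rule quotientE) (simp only: cls F quotientI)
    ultimately show "(\<lambda>C. S `` (F ` C)) ` (A // R) = B // S"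
      by (intro equalityI image_subsetI)
  qed
qed

text \<open>A property of a given map rather than of two spaces, because the maps at different times
  have to form a natural transformation.\<close>

definition homotopy_equivalence_map :: "'a topology \<Rightarrow> 'b topology \<Rightarrow> ('a \<Rightarrow> 'b) \<Rightarrow> bool" where
  "homotopy_equivalence_map X Y f \<longleftrightarrow> continuous_map X Y f \<and>
     (\<exists>g. continuous_map Y X g \<and> homotopic_with (\<lambda>_. True) X X id (g \<circ> f) \<and>
        homotopic_with (\<lambda>_. True) Y Y id (f \<circ> g))"

lemma equiv_based_homotopic:
  "equiv (based_maps n X x) {(g, h). based_homotopic n X x g h}"
proof (rule equivI)
  show "{(g, h). based_homotopic n X x g h} \<subseteq> based_maps n X x \<times> based_maps n X x"
    by (auto simp: based_maps_def dest: based_homotopic_imp)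
  show "refl_on (based_maps n X x) {(g, h). based_homotopic n X x g h}"
    by (rule refl_onI) (auto simp: based_maps_def based_homotopic_def)
qed (auto intro!: symI transI intro: based_homotopic_sym based_homotopic_trans)

lemma homotopic_to_id_path_component:
  assumes h: "homotopic_with (\<lambda>_. True) X X id \<phi>" and x: "x \<in> topspace X"
  shows "path_component_of X x (\<phi> x)"
proof -
  obtain H where H: "continuous_map (prod_topology unit_interval X) X H"
      "\<And>y. H (0, y) = y" "\<And>y. H (1, y) = \<phi> y"
    using h unfolding homotopic_with_def by auto
  have "pathin X (\<lambda>u. H (u, x))"
    unfolding pathin_def
    by (intro continuous_map_compose [OF _ H(1), unfolded o_def] continuous_map_pairedI) (auto simp: x)
  then show ?thesis unfolding path_component_of_def using H by auto
qed

lemma path_component_of_continuous_image: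
  assumes "continuous_map X Y f" "path_component_of X x y"
  shows "path_component_of Y (f x) (f y)"
proof -
  obtain g where "pathin X g" "g 0 = x" "g 1 = y"
    using assms(2) unfolding path_component_of_def by blast
  then have "pathin Y (f \<circ> g)" "(f \<circ> g) 0 = f x" "(f \<circ> g) 1 = f y"
    using pathin_compose assms(1) by auto
  then show ?thesis unfolding path_component_of_def by blast
qed

lemma quotient_path_component_of:
  "topspace X // {(x, y). path_component_of X x y} = path_components_of X"
  by (auto simp: quotient_def path_components_of_def)

theorem homotopy_equivalence_imp_weak:
  assumes "homotopy_equivalence_map X Y f"
  shows "weak_homotopy_equivalence X Y f"
proof -
  obtain g where f: "continuous_map X Y f" and g: "continuous_map Y X g"
    and gf: "homotopic_with (\<lambda>_. True) X X id (g \<circ> f)"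
    and fg: "homotopic_with (\<lambda>_. True) Y Y id (f \<circ> g)"
    using assms unfolding homotopy_equivalence_map_def by blast
  have fX: "f x \<in> topspace Y" if "x \<in> topspace X" for x
    using f that by (auto simp: continuous_map_def)
  have gY: "g y \<in> topspace X" if "y \<in> topspace Y" for y
    using g that by (auto simp: continuous_map_def)
  let ?P = "{(x, y). path_component_of X x y}" and ?Q = "{(x, y). path_component_of Y x y}"
  have "bij_betw (\<lambda>C. ?Q `` (f ` C)) (topspace X // ?P) (topspace Y // ?Q)"
  proof (rule bij_betw_quotient)
    show "equiv (topspace X) ?P" "equiv (topspace Y) ?Q"
      by (auto intro!: equivI refl_onI symI transI simp: path_component_of_refl
          intro: path_component_of_sym path_component_of_trans
          dest: path_component_in_topspace)
    show "(f x, f y) \<in> ?Q \<longleftrightarrow> (x, y) \<in> ?P" if "x \<in> topspace X" "y \<in> topspace X" for x y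
    proof
      assume "(f x, f y) \<in> ?Q"
      then have "path_component_of X (g (f x)) (g (f y))"
        using path_component_of_continuous_image [OF g] by auto
      with homotopic_to_id_path_component [OF gf] that show "(x, y) \<in> ?P"
        by (metis comp_apply case_prodI mem_Collect_eq path_component_of_sym path_component_of_trans)
    qed (use path_component_of_continuous_image [OF f] in auto)
    show "\<exists>x\<in>topspace X. (f x, y) \<in> ?Q" if "y \<in> topspace Y" for y
      using homotopic_to_id_path_component [OF fg that] gY that
      by (metis case_prodI comp_apply mem_Collect_eq path_component_of_sym)
  qed (use fX in auto)
  moreover have "?Q `` (f ` C) = {y. \<exists>x\<in>C. path_component_of Y (f x) y}" for C
    by auto
  ultimately have components: "bij_betw (\<lambda>C. {y. \<exists>x\<in>C. path_component_of Y (f x) y})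
       (path_components_of X) (path_components_of Y)"
    by (simp add: quotient_path_component_of)
  have groups: "bij_betw (\<lambda>C. {h. \<exists>k\<in>C. based_homotopic n Y (f x) (f \<circ> k) h})
          (homotopy_classes n X x) (homotopy_classes n Y (f x))"
    if n: "1 \<le> n" and x: "x \<in> topspace X" for n x
  proof -
    let ?P = "{(k, h). based_homotopic n X x k h}" and ?Q = "{(k, h). based_homotopic n Y (f x) k h}"
    have "bij_betw (\<lambda>C. ?Q `` ((\<lambda>k. f \<circ> k) ` C)) (based_maps n X x // ?P) (based_maps n Y (f x) // ?Q)"
    proof (rule bij_betw_quotient [OF equiv_based_homotopic equiv_based_homotopic])
      show "f \<circ> \<alpha> \<in> based_maps n Y (f x)" if "\<alpha> \<in> based_maps n X x" for \<alpha>
        using that f by (auto simp: based_maps_def intro: continuous_map_compose)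
      show "(f \<circ> \<alpha>, f \<circ> \<beta>) \<in> ?Q \<longleftrightarrow> (\<alpha>, \<beta>) \<in> ?P"
        if "\<alpha> \<in> based_maps n X x" "\<beta> \<in> based_maps n X x" for \<alpha> \<beta>
      proof
        assume "(f \<circ> \<alpha>, f \<circ> \<beta>) \<in> ?Q"
        then have "based_homotopic n X (g (f x)) (g \<circ> (f \<circ> \<alpha>)) (g \<circ> (f \<circ> \<beta>))"
          using based_homotopic_compose g by auto
        then show "(\<alpha>, \<beta>) \<in> ?P"
          using homotopic_to_id_reflects_based_homotopic [OF n gf x] that
          by (simp add: based_maps_def o_assoc)
      qed (use based_homotopic_compose f in auto)
      \<comment> \<open>Surjectivity: \<open>g \<circ> \<beta>\<close> is lifted through
        \<open>g \<circ> f\<close>, the result is pushed forward by \<open>f\<close>, and the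
        surplus \<open>f \<circ> g\<close>, being homotopic to the identity, is cancelled by
        reflection.\<close>
      fix \<beta> assume \<beta>: "\<beta> \<in> based_maps n Y (f x)"
      then have "g \<circ> \<beta> \<in> based_maps n X ((g \<circ> f) x)"
        using g by (auto simp: based_maps_def intro: continuous_map_compose)
      then obtain \<alpha> where \<alpha>: "\<alpha> \<in> based_maps n X x"
          and h: "based_homotopic n X ((g \<circ> f) x) (g \<circ> f \<circ> \<alpha>) (g \<circ> \<beta>)"
        using homotopic_to_id_lifts_based_map [OF n gf x] by metis
      have "based_homotopic n Y (f ((g \<circ> f) x)) (f \<circ> (g \<circ> f \<circ> \<alpha>)) (f \<circ> (g \<circ> \<beta>))"
        by (rule based_homotopic_compose [OF h f])
      then have "based_homotopic n Y (f x) (f \<circ> \<alpha>) \<beta>"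
        using \<alpha> \<beta> f
        by (intro homotopic_to_id_reflects_based_homotopic [OF n fg fX [OF x]])
          (auto simp: based_maps_def o_assoc intro: continuous_map_compose)
      with \<alpha> show "\<exists>\<alpha>\<in>based_maps n X x. (f \<circ> \<alpha>, \<beta>) \<in> ?Q" by auto
    qed
    moreover have "?Q `` ((\<lambda>k. f \<circ> k) ` C) = {h. \<exists>k\<in>C. based_homotopic n Y (f x) (f \<circ> k) h}" for C
      by auto
    ultimately show ?thesis
      by (simp add: homotopy_classes_def based_maps_def)
  qed
  show ?thesis
    using f components groups by (simp add: weak_homotopy_equivalence_def)
qed

lemma homotopic_with_conjugate:
  assumes "homotopic_with (\<lambda>_. True) Y Y k l" "continuous_map X Y f" "continuous_map Y Z h"
  shows "homotopic_with (\<lambda>_. True) X Z (h \<circ> k \<circ> f) (h \<circ> l \<circ> f)"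
  by (rule homotopic_with_compose_continuous_map_right
        [OF homotopic_with_compose_continuous_map_left [OF assms(1,3)] assms(2)]) auto

lemma homotopy_equivalence_map_compose:
  assumes "homotopy_equivalence_map X Y f" "homotopy_equivalence_map Y Z h"
  shows "homotopy_equivalence_map X Z (h \<circ> f)"
proof -
  obtain f' where f: "continuous_map X Y f" "continuous_map Y X f'"
      "homotopic_with (\<lambda>_. True) X X id (f' \<circ> f)" "homotopic_with (\<lambda>_. True) Y Y id (f \<circ> f')"
    using assms(1) unfolding homotopy_equivalence_map_def by blast
  obtain h' where h: "continuous_map Y Z h" "continuous_map Z Y h'"
      "homotopic_with (\<lambda>_. True) Y Y id (h' \<circ> h)" "homotopic_with (\<lambda>_. True) Z Z id (h \<circ> h')"
    using assms(2) unfolding homotopy_equivalence_map_def by blast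
  have "homotopic_with (\<lambda>_. True) X X (f' \<circ> id \<circ> f) (f' \<circ> (h' \<circ> h) \<circ> f)"
    by (rule homotopic_with_conjugate [OF h(3) f(1,2)])
  moreover have "homotopic_with (\<lambda>_. True) Z Z (h \<circ> id \<circ> h') (h \<circ> (f \<circ> f') \<circ> h')"
    by (rule homotopic_with_conjugate [OF f(4) h(2,1)])
  ultimately have "homotopic_with (\<lambda>_. True) X X id ((f' \<circ> h') \<circ> (h \<circ> f))"
     "homotopic_with (\<lambda>_. True) Z Z id ((h \<circ> f) \<circ> (f' \<circ> h'))"
    using f(3) h(4) homotopic_with_trans by (auto simp: o_assoc)
  moreover have "continuous_map X Z (h \<circ> f)" "continuous_map Z X (f' \<circ> h')"
    using f h continuous_map_compose by blast+
  ultimately show ?thesis unfolding homotopy_equivalence_map_def by blast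
qed

text \<open>Part of two-out-of-three. The inverse of \<open>h\<close> is \<open>f \<circ> k\<close>:
  inserting \<open>f \<circ> f'\<close> on the right of \<open>f \<circ> k \<circ> h\<close>
  produces \<open>f \<circ> (k \<circ> h \<circ> f) \<circ> f'\<close>, which deforms to
  \<open>f \<circ> f'\<close> and so to the identity.\<close>

lemma homotopy_equivalence_map_cancel_right:
  assumes "homotopy_equivalence_map X Y f" "homotopy_equivalence_map X Z (h \<circ> f)"
    and h: "continuous_map Y Z h"
  shows "homotopy_equivalence_map Y Z h"
proof -
  obtain f' where f: "continuous_map X Y f" "continuous_map Y X f'"
      "homotopic_with (\<lambda>_. True) X X id (f' \<circ> f)" "homotopic_with (\<lambda>_. True) Y Y id (f \<circ> f')"
    using assms(1) unfolding homotopy_equivalence_map_def by blast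
  obtain k where k: "continuous_map Z X k"
      "homotopic_with (\<lambda>_. True) X X id (k \<circ> (h \<circ> f))" "homotopic_with (\<lambda>_. True) Z Z id ((h \<circ> f) \<circ> k)"
    using assms(2) unfolding homotopy_equivalence_map_def by blast
  have "homotopic_with (\<lambda>_. True) Y Y ((f \<circ> k \<circ> h) \<circ> id) ((f \<circ> k \<circ> h) \<circ> (f \<circ> f'))"
    by (rule homotopic_with_compose_continuous_map_left [OF f(4)])
      (auto intro!: continuous_map_compose h f k)
  moreover have "homotopic_with (\<lambda>_. True) Y Y (f \<circ> id \<circ> f') (f \<circ> (k \<circ> (h \<circ> f)) \<circ> f')"
    by (rule homotopic_with_conjugate [OF k(2) f(2,1)])
  ultimately have "homotopic_with (\<lambda>_. True) Y Y id ((f \<circ> k) \<circ> h)"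
    using f(4) by (simp add: o_assoc) (metis homotopic_with_symD homotopic_with_trans)
  moreover have "homotopic_with (\<lambda>_. True) Z Z id (h \<circ> (f \<circ> k))"
    using k(3) by (simp add: o_assoc)
  moreover have "continuous_map Z Y (f \<circ> k)"
    using f k continuous_map_compose by blast
  ultimately show ?thesis using h unfolding homotopy_equivalence_map_def by blast
qed

lemma homotopy_equivalence_map_homeomorphic:
  assumes "homeomorphic_map X Y f"
  shows "homotopy_equivalence_map X Y f"
proof -
  obtain g where "homeomorphic_maps X Y f g"
    using assms homeomorphic_map_maps by blast
  then have "continuous_map X Y f" "continuous_map Y X g"
    "\<And>x. x \<in> topspace X \<Longrightarrow> g (f x) = x" "\<And>y. y \<in> topspace Y \<Longrightarrow> f (g y) = y"
    by (auto simp: homeomorphic_maps_def)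
  then show ?thesis
    unfolding homotopy_equivalence_map_def by (auto intro!: exI [of _ g] homotopic_with_equal)
qed

section \<open>Compactly generated Hausdorff spaces\<close>

text \<open>A copy of a space over another type, along an injection. It turns compact subsets into
  probes over \<open>'a set set\<close> and places the cylinder in the universe of the
  distance.\<close>

definition relabelled_topology :: "('a \<Rightarrow> 'b) \<Rightarrow> 'a topology \<Rightarrow> 'b topology" where
  "relabelled_topology e Z = pullback_topology (e ` topspace Z) (inv_into (topspace Z) e) Z"

lemma homeomorphic_map_relabelled:
  assumes "inj_on e (topspace Z)"
  shows "homeomorphic_map Z (relabelled_topology e Z) e"
proof -
  have "homeomorphic_maps Z (relabelled_topology e Z) e (inv_into (topspace Z) e)"
    unfolding homeomorphic_maps_def
  proof (intro conjI ballI)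
    have "continuous_map Z Z (inv_into (topspace Z) e \<circ> e)"
      by (rule continuous_map_eq [OF continuous_map_id]) (use assms in auto)
    then show "continuous_map Z (relabelled_topology e Z) e"
      unfolding relabelled_topology_def by (intro continuous_map_pullback') auto
    have "continuous_map (relabelled_topology e Z) Z (id \<circ> inv_into (topspace Z) e)"
      unfolding relabelled_topology_def by (intro continuous_map_pullback continuous_map_id)
    then show "continuous_map (relabelled_topology e Z) Z (inv_into (topspace Z) e)"
      by simp
  qed (use assms in \<open>auto simp: relabelled_topology_def topspace_pullback_topology\<close>)
  then show ?thesis using homeomorphic_map_maps by blast
qed

text \<open>In a Hausdorff space every compact subset is itself compact Hausdorff, hence a probe
  once its points are renamed to double singletons. Preimages under these probes are the traces that
  the k-space condition tests.\<close>

lemma compactly_generated_k_space: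
  assumes X: "k_space X"  and H: "Hausdorff_space X"
  shows "compactly_generated X"
  unfolding compactly_generated_def
proof (intro allI impI)
  fix A assume A: "A \<subseteq> topspace X"
    and cl: "\<forall>K u. probe K u X \<longrightarrow> closedin K {z \<in> topspace K. u z \<in> A}"
  have "closedin (subtopology X S) (S \<inter> A)" if S: "compactin X S" for S
  proof -
    let ?S = "subtopology X S" and ?e = "\<lambda>x. {{x}}"
    have SX: "topspace ?S = S" using S compactin_subset_topspace by fastforce
    have e: "homeomorphic_map ?S (relabelled_topology ?e ?S) ?e"
      by (intro homeomorphic_map_relabelled inj_onI) auto
    then obtain u where u: "homeomorphic_maps ?S (relabelled_topology ?e ?S) ?e u"
      using homeomorphic_map_maps by blast
    then have hs: "?S homeomorphic_space relabelled_topology ?e ?S"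
      using homeomorphic_space_def by blast
    have "probe (relabelled_topology ?e ?S) u X"
      unfolding probe_def
    proof (intro conjI)
      show "compact_space (relabelled_topology ?e ?S)"
        using homeomorphic_compact_space [OF hs] S compact_space_subtopology by blast
      show "Hausdorff_space (relabelled_topology ?e ?S)"
        using homeomorphic_Hausdorff_space [OF hs] H Hausdorff_space_subtopology by blast
      show "continuous_map (relabelled_topology ?e ?S) X u"
        using u by (simp add: homeomorphic_maps_def continuous_map_in_subtopology)
    qed
    then have "closedin (relabelled_topology ?e ?S) {z \<in> topspace (relabelled_topology ?e ?S). u z \<in> A}"
      using cl by blast
    moreover have c: "continuous_map ?S (relabelled_topology ?e ?S) ?e"
      using u homeomorphic_maps_def by blast
    ultimately have "closedin ?S {x \<in> topspace ?S. ?e x \<in> {z \<in> topspace (relabelled_topology ?e ?S). u z \<in> A}}"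
      by (rule closedin_continuous_map_preimage [rotated])
    also have "{x \<in> topspace ?S. ?e x \<in> {z \<in> topspace (relabelled_topology ?e ?S). u z \<in> A}} = S \<inter> A"
      using u c SX by (auto simp: homeomorphic_maps_def continuous_map_def)
    finally show ?thesis .
  qed
  then show "closedin X A" using X A by (simp add: k_space)
qed

lemma cgwh_k_space:
  assumes "k_space X" "Hausdorff_space X"
  shows "cgwh X"
proof -
  have "weakly_Hausdorff X"
    unfolding weakly_Hausdorff_def probe_def
    using assms(2) compactin_imp_closedin image_compactin compact_space_def by blast
  then show ?thesis
    using compactly_generated_k_space [OF assms] by (simp add: cgwh_def)
qed

lemma kify_compactly_generated:
  assumes "compactly_generated X"
  shows "kify X = X"
proof (rule topology_eq [THEN iffD2], intro allI iffI)
  fix U assume "openin X U"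
  then show "openin (kify X) U"
    by (auto simp: openin_kify probe_def openin_subset intro: openin_continuous_map_preimage)
next
  fix U assume U: "openin (kify X) U"
  have "closedin X (topspace X - U)"
  proof (rule assms [unfolded compactly_generated_def, rule_format])
    fix K u assume K: "probe K u X"
    then have "openin K {z \<in> topspace K. u z \<in> U}" using U by (simp add: openin_kify)
    then have "closedin K (topspace K - {z \<in> topspace K. u z \<in> U})" by blast
    also have "topspace K - {z \<in> topspace K. u z \<in> U} = {z \<in> topspace K. u z \<in> topspace X - U}"
      using K by (auto simp: probe_def continuous_map_def)
    finally show "closedin K {z \<in> topspace K. u z \<in> topspace X - U}" .
  qed auto
  then show "openin X U"
    using U unfolding openin_kify by (simp add: openin_closedin_eq)
qed

section \<open>Finite simplicial complexes\<close>

lemma closed_simplex_compact: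
  fixes \<sigma> :: "'v set"
  shows "compact (closed_simplex \<sigma>)"
proof -
  let ?B = "\<lambda>v. if v \<in> \<sigma> then {0..1::real} else {0}"
  have "compact (PiE UNIV ?B)"
  proof -
    have "compactin (product_topology (\<lambda>_. euclideanreal) UNIV) (PiE UNIV ?B)"
      by (subst compactin_PiE) auto
    then show ?thesis by (simp add: euclidean_product_topology)
  qed
  moreover have "continuous_on UNIV (\<lambda>t :: 'v \<Rightarrow> real. \<Sum>v\<in>\<sigma>. t v)"
    by (intro continuous_on_sum continuous_on_product_coordinates)
  then have "closed {t :: 'v \<Rightarrow> real. sum t \<sigma> = 1}"
    using closed_Collect_eq [OF _ continuous_on_const] by blast
  moreover have "closed_simplex \<sigma> = PiE UNIV ?B \<inter> {t. sum t \<sigma> = 1}"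
  proof (intro equalityI subsetI)
    fix t assume t: "t \<in> closed_simplex \<sigma>"
    \<comment> \<open>A sum over an infinite set is 0 by convention, so an infinite
      \<open>\<sigma>\<close> spans an empty simplex.\<close>
    then have "finite \<sigma>" unfolding closed_simplex_def using sum.infinite by fastforce
    then have "t v \<le> 1" if "v \<in> \<sigma>" for v
      using t member_le_sum [OF that, of t] by (auto simp: closed_simplex_def)
    then show "t \<in> PiE UNIV ?B \<inter> {t. sum t \<sigma> = 1}"
      using t by (auto simp: closed_simplex_def)
  qed (auto simp: closed_simplex_def PiE_iff split: if_splits)
  ultimately show ?thesis by (simp add: compact_Int_closed)
qed

lemma Hausdorff_space_function_space: "Hausdorff_space (euclidean :: ('v \<Rightarrow> real) topology)"
  by (simp add: euclidean_product_topology [symmetric] Hausdorff_space_product_topology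
      Hausdorff_space_euclidean)

lemma closed_simplex_closed: "closed (closed_simplex \<sigma>)"
  using compactin_imp_closedin [OF Hausdorff_space_function_space] closed_simplex_compact
  by (metis closed_closedin compactin_euclidean_iff)

definition geometric_carrier :: "'v set set \<Rightarrow> ('v \<Rightarrow> real) set" where
  "geometric_carrier K = \<Union> (closed_simplex ` K)"

text \<open>Simplices are closed, so a set that is relatively closed in each of finitely many
  simplices is a finite union of closed sets. Continuity on realizations thereby becomes
  \<open>continuous_on\<close>.\<close>

lemma realization_finite:
  assumes "finite K"
  shows "realization K = top_of_set (geometric_carrier K)"
proof (rule topology_eq [THEN iffD2], intro allI iffI)
  fix U assume "openin (top_of_set (geometric_carrier K)) U"
  then obtain V where V: "open V" "U = geometric_carrier K \<inter> V" by (auto simp: openin_open)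
  then have "U \<inter> closed_simplex \<sigma> = closed_simplex \<sigma> \<inter> V" if "\<sigma> \<in> K" for \<sigma>
    using that by (auto simp: geometric_carrier_def)
  with V show "openin (realization K) U"
    by (auto simp: openin_realization geometric_carrier_def openin_open)
next
  fix U assume U: "openin (realization K) U"
  have "closed (closed_simplex \<sigma> - U)" if \<sigma>: "\<sigma> \<in> K" for \<sigma>
  proof -
    obtain V where V: "open V" "U \<inter> closed_simplex \<sigma> = closed_simplex \<sigma> \<inter> V"
      using U \<sigma> by (auto simp: openin_realization openin_open)
    then have "closed_simplex \<sigma> - U = closed_simplex \<sigma> - V" by blast
    moreover have "closed (closed_simplex \<sigma> - V)"
      by (intro closed_Diff V closed_simplex_closed)
    ultimately show ?thesis by simp
  qed
  then have "closed (\<Union>\<sigma>\<in>K. closed_simplex \<sigma> - U)"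
    using assms by blast
  moreover have "geometric_carrier K \<inter> - (\<Union>\<sigma>\<in>K. closed_simplex \<sigma> - U) = U"
    using U by (auto simp: openin_realization geometric_carrier_def)
  ultimately show "openin (top_of_set (geometric_carrier K)) U"
    by (metis openin_open open_Compl)
qed

definition finite_complex :: "'v set set \<Rightarrow> bool" where
  "finite_complex K \<longleftrightarrow> finite K \<and> (\<forall>\<sigma>\<in>K. finite \<sigma> \<and> \<sigma> \<noteq> {} \<and> (\<forall>\<tau>\<subseteq>\<sigma>. \<tau> \<noteq> {} \<longrightarrow> \<tau> \<in> K))"

text \<open>The support of a point is the smallest simplex containing it, and a complex contains the
  faces of its simplices. Membership can thus be decided from the support alone.\<close>

lemma mem_geometric_carrier:
  assumes "finite_complex K"
  shows "t \<in> geometric_carrier K \<longleftrightarrow>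
    (\<forall>v. 0 \<le> t v) \<and> {v. t v \<noteq> 0} \<in> K \<and> sum t {v. t v \<noteq> 0} = 1"
proof
  assume "t \<in> geometric_carrier K"
  then obtain \<sigma> where \<sigma>: "\<sigma> \<in> K" "t \<in> closed_simplex \<sigma>" by (auto simp: geometric_carrier_def)
  then have sub: "{v. t v \<noteq> 0} \<subseteq> \<sigma>" and fin: "finite \<sigma>"
    using assms by (auto simp: closed_simplex_def finite_complex_def)
  have "sum t {v. t v \<noteq> 0} = sum t \<sigma>"
    using sub fin by (intro sum.mono_neutral_left) auto
  then have s: "sum t {v. t v \<noteq> 0} = 1" using \<sigma> by (simp add: closed_simplex_def)
  then have "{v. t v \<noteq> 0} \<noteq> {}" by (metis sum.empty zero_neq_one)
  then have "{v. t v \<noteq> 0} \<in> K"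
    using \<sigma> sub assms unfolding finite_complex_def by blast
  then show "(\<forall>v. 0 \<le> t v) \<and> {v. t v \<noteq> 0} \<in> K \<and> sum t {v. t v \<noteq> 0} = 1"
    using s \<sigma> by (simp add: closed_simplex_def)
next
  assume "(\<forall>v. 0 \<le> t v) \<and> {v. t v \<noteq> 0} \<in> K \<and> sum t {v. t v \<noteq> 0} = 1"
  then have "t \<in> closed_simplex {v. t v \<noteq> 0}" "{v. t v \<noteq> 0} \<in> K" by (auto simp: closed_simplex_def)
  then show "t \<in> geometric_carrier K" unfolding geometric_carrier_def by blast
qed

lemma geometric_carrier_mono: "K \<subseteq> L \<Longrightarrow> geometric_carrier K \<subseteq> geometric_carrier L"
  by (auto simp: geometric_carrier_def)

lemma continuous_map_realization_inclusion:
  assumes "finite L" "K \<subseteq> L"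
  shows "continuous_map (realization K) (realization L) (\<lambda>t. t)"
  using geometric_carrier_mono [OF assms(2)] finite_subset [OF assms(2,1)] assms(1)
  by (auto simp: realization_finite)

section \<open>Removal of a dominated vertex\<close>

definition move_weight :: "'v \<Rightarrow> 'v \<Rightarrow> real \<Rightarrow> ('v \<Rightarrow> real) \<Rightarrow> 'v \<Rightarrow> real" where
  "move_weight i j s t v = (if v = i then (1 - s) * t i else if v = j then t j + s * t i else t v)"

lemma move_weight_closed_simplex:
  assumes "finite \<sigma>" "t \<in> closed_simplex \<sigma>" "s \<in> {0..1}" "i \<in> \<sigma>" "i \<noteq> j"
  shows "move_weight i j s t \<in> closed_simplex (insert j \<sigma>)"
proof -
  let ?r = "insert j \<sigma> - {i, j}"
  have dec: "sum u (insert j \<sigma>) = u i + (u j + sum u ?r)" for u :: "'a \<Rightarrow> real"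
  proof -
    have "insert j \<sigma> = insert i (insert j ?r)" using assms by auto
    then have "sum u (insert j \<sigma>) = sum u (insert i (insert j ?r))" by simp
    also have "\<dots> = u i + (u j + sum u ?r)" using assms by (subst sum.insert; simp)
    finally show ?thesis .
  qed
  have "sum t (insert j \<sigma>) = 1"
    using assms by (cases "j \<in> \<sigma>") (auto simp: closed_simplex_def insert_absorb)
  moreover have "sum (move_weight i j s t) ?r = sum t ?r"
    by (intro sum.cong) (auto simp: move_weight_def)
  ultimately have "sum (move_weight i j s t) (insert j \<sigma>) = 1"
    using assms(5) unfolding dec by (simp add: move_weight_def algebra_simps)
  then show ?thesis
    using assms by (auto simp: closed_simplex_def move_weight_def)
qed

lemma continuous_on_move_weight:
  "continuous_on S (\<lambda>z. move_weight i j (fst z) (snd z))"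
proof (rule continuous_on_coordinatewise_then_product)
  have c: "continuous_on S (\<lambda>z. snd z v)" for v and S :: "(real \<times> ('a \<Rightarrow> real)) set"
    by (rule continuous_on_product_then_coordinatewise) (intro continuous_intros)
  show "continuous_on S (\<lambda>z. move_weight i j (fst z) (snd z) v)" for v
    unfolding move_weight_def by (cases "v = i"; cases "v = j") (auto intro!: continuous_intros c)
qed

text \<open>\<open>move_weight\<close> slides the weight of \<open>i\<close> linearly onto
  \<open>j\<close>. Domination keeps the sliding point inside the complex, and at time 1 the vertex
  \<open>i\<close> has left its support; points without weight at \<open>i\<close> never move, so
  this is a deformation retraction.\<close>

lemma homotopy_equivalence_dominated_vertex:
  fixes K :: "'v set set"
  assumes K: "finite_complex K" and ij: "i \<noteq> j"
    and dom: "\<And>\<sigma>. \<sigma> \<in> K \<Longrightarrow> i \<in> \<sigma> \<Longrightarrow> insert j \<sigma> \<in> K"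
  shows "homotopy_equivalence_map (realization {\<sigma> \<in> K. i \<notin> \<sigma>}) (realization K) (\<lambda>t. t)"
proof -
  let ?L = "{\<sigma> \<in> K. i \<notin> \<sigma>}"
  have fin: "finite K" "finite ?L" using K by (auto simp: finite_complex_def)
  have id: "move_weight i j s t = t" if "t i = 0" for s t
    using that by (auto simp: move_weight_def)
  have L0: "t i = 0" if "t \<in> geometric_carrier ?L" for t
    using that by (auto simp: geometric_carrier_def closed_simplex_def)
  have inK: "move_weight i j s t \<in> geometric_carrier K" if s: "s \<in> {0..1}" and t: "t \<in> geometric_carrier K" for s t
  proof -
    obtain \<sigma> where \<sigma>: "\<sigma> \<in> K" "t \<in> closed_simplex \<sigma>" using t by (auto simp: geometric_carrier_def)
    show ?thesis
    proof (cases "i \<in> \<sigma>")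
      case True
      then have "move_weight i j s t \<in> closed_simplex (insert j \<sigma>)"
        using \<sigma> K s ij by (intro move_weight_closed_simplex) (auto simp: finite_complex_def)
      then show ?thesis using dom \<sigma> True by (auto simp: geometric_carrier_def)
    next
      case False
      then show ?thesis using \<sigma> t by (auto simp: closed_simplex_def id)
    qed
  qed
  have inL: "move_weight i j 1 t \<in> geometric_carrier ?L" if t: "t \<in> geometric_carrier K" for t
  proof -
    have m: "move_weight i j 1 t \<in> geometric_carrier K" using inK t by simp
    have sub: "?L \<subseteq> K" and "finite_complex ?L"
      using K by (auto simp: finite_complex_def)
    moreover have "i \<notin> {v. move_weight i j 1 t v \<noteq> 0}" by (simp add: move_weight_def)
    ultimately show ?thesis
      using m by (simp add: mem_geometric_carrier K)
  qed
  have cont: "continuous_map (prod_topology unit_interval (realization K)) (realization K)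
      (\<lambda>z. move_weight i j (fst z) (snd z))"
    using inK fin by (auto simp: realization_finite prod_topology_subtopology_eu continuous_on_move_weight)
  have r: "continuous_map (realization K) (realization ?L) (move_weight i j 1)"
  proof -
    have "continuous_on (geometric_carrier K) (\<lambda>t. move_weight i j 1 t)"
      by (rule continuous_on_compose2 [OF continuous_on_move_weight [of UNIV], of _ "\<lambda>t. (1, t)", simplified])
        (intro continuous_intros)
    then show ?thesis using inL fin by (auto simp: realization_finite)
  qed
  show ?thesis
    unfolding homotopy_equivalence_map_def
  proof (intro conjI exI [of _ "move_weight i j 1"] r)
    show "continuous_map (realization ?L) (realization K) (\<lambda>t. t)"
      by (rule continuous_map_realization_inclusion) (use fin in auto)
    show "homotopic_with (\<lambda>_. True) (realization ?L) (realization ?L) id (move_weight i j 1 \<circ> (\<lambda>t. t))"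
      by (rule homotopic_with_equal) (use L0 id fin in \<open>auto simp: realization_finite\<close>)
    show "homotopic_with (\<lambda>_. True) (realization K) (realization K) id ((\<lambda>t. t) \<circ> move_weight i j 1)"
      unfolding homotopic_with_def
      by (intro exI [of _ "\<lambda>z. move_weight i j (fst z) (snd z)"] conjI cont)
        (auto simp: move_weight_def fun_eq_iff)
  qed
qed

text \<open>Barycentric coordinates pushed forward along a renaming of vertices. It links complexes
  on indices with the Cech complex, whose vertices are the points of \<open>P\<close>
  themselves.\<close>

definition relabel :: "'v set \<Rightarrow> ('v \<Rightarrow> 'w) \<Rightarrow> ('v \<Rightarrow> real) \<Rightarrow> 'w \<Rightarrow> real" where
  "relabel A f t w = (if w \<in> f ` A then t (inv_into A f w) else 0)"

lemma continuous_on_relabel: "continuous_on S (relabel A f)"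
proof (rule continuous_on_coordinatewise_then_product)
  show "continuous_on S (\<lambda>t. relabel A f t w)" for w
    unfolding relabel_def
    by (cases "w \<in> f ` A") (auto intro: continuous_on_product_coordinates continuous_on_subset)
qed

lemma relabel_closed_simplex:
  assumes f: "inj_on f A" and "\<sigma> \<subseteq> A" "t \<in> closed_simplex \<sigma>"
  shows "relabel A f t \<in> closed_simplex (f ` \<sigma>)"
proof -
  have "sum (relabel A f t) (f ` \<sigma>) = sum (relabel A f t \<circ> f) \<sigma>"
    using assms by (intro sum.reindex) (auto intro: inj_on_subset)
  also have "\<dots> = sum t \<sigma>"
    using assms by (intro sum.cong) (auto simp: relabel_def subset_iff)
  finally show ?thesis using assms by (auto simp: closed_simplex_def relabel_def)
qed

lemma homeomorphic_map_relabel: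
  fixes K :: "'v set set" and f :: "'v \<Rightarrow> 'w"
  assumes f: "inj_on f A" and K: "finite K" "\<And>\<sigma>. \<sigma> \<in> K \<Longrightarrow> \<sigma> \<subseteq> A"
  shows "homeomorphic_map (realization K) (realization ((`) f ` K)) (relabel A f)"
proof -
  let ?g = "inv_into A f"
  have g: "inj_on ?g (f ` A)" "?g ` f ` A = A" using f by (auto simp: inj_on_inv_into)
  have gf: "relabel (f ` A) ?g (relabel A f t) = t" if "\<sigma> \<in> K" "t \<in> closed_simplex \<sigma>" for t \<sigma>
  proof
    fix v
    show "relabel (f ` A) ?g (relabel A f t) v = t v"
    proof (cases "v \<in> A")
      case True
      then have "inv_into (f ` A) ?g v = f v"
        using f g by (metis image_eqI inv_into_f_f)
      then show ?thesis using True f g by (simp add: relabel_def)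
    next
      case False
      then have "v \<notin> \<sigma>" using that K by auto
      then show ?thesis using False that g by (simp add: relabel_def closed_simplex_def)
    qed
  qed
  have fg: "relabel A f (relabel (f ` A) ?g t) = t" if "\<sigma> \<in> K" "t \<in> closed_simplex (f ` \<sigma>)" for t \<sigma>
  proof
    fix w
    show "relabel A f (relabel (f ` A) ?g t) w = t w"
    proof (cases "w \<in> f ` A")
      case True
      then have "inv_into (f ` A) ?g (?g w) = w" "?g w \<in> A"
        using g by (auto simp: inv_into_into)
      then show ?thesis using True g by (simp add: relabel_def)
    next
      case False
      then have "w \<notin> f ` \<sigma>" using that K by auto
      then show ?thesis using False that by (simp add: relabel_def closed_simplex_def)
    qed
  qed
  have "homeomorphic_maps (realization K) (realization ((`) f ` K)) (relabel A f) (relabel (f ` A) ?g)"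
    unfolding homeomorphic_maps_def realization_finite [OF K(1)]
      realization_finite [OF finite_imageI [OF K(1)]]
  proof (intro conjI ballI)
    have "relabel A f t \<in> geometric_carrier ((`) f ` K)" if "t \<in> geometric_carrier K" for t
      using that relabel_closed_simplex [OF f K(2)] unfolding geometric_carrier_def by blast
    then show "continuous_map (top_of_set (geometric_carrier K)) (top_of_set (geometric_carrier ((`) f ` K))) (relabel A f)"
      by (auto simp: continuous_on_relabel)
    have "relabel (f ` A) ?g t \<in> closed_simplex \<sigma>"
      if "\<sigma> \<in> K" "t \<in> closed_simplex (f ` \<sigma>)" for t \<sigma>
    proof -
      have "?g ` f ` \<sigma> = \<sigma>" using f K(2) [OF that(1)] by (auto simp: image_iff subset_iff)
      then show ?thesis using relabel_closed_simplex [OF g(1) _ that(2)] K(2) [OF that(1)] by auto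
    qed
    then have "relabel (f ` A) ?g t \<in> geometric_carrier K" if "t \<in> geometric_carrier ((`) f ` K)" for t
      using that unfolding geometric_carrier_def by blast
    then show "continuous_map (top_of_set (geometric_carrier ((`) f ` K))) (top_of_set (geometric_carrier K)) (relabel (f ` A) ?g)"
      by (auto simp: continuous_on_relabel)
  qed (use gf fg in \<open>auto simp: geometric_carrier_def\<close>)
  then show ?thesis using homeomorphic_map_maps by blast
qed

section \<open>The p-norm\<close>

text \<open>Convexity including the endpoint 0: if one argument vanishes, the claim reduces to
  \<open>c powr q \<le> c\<close> for \<open>c\<close> in the unit interval.\<close>

lemma powr_convex_nonneg:
  fixes q :: real
  assumes "1 \<le> q" "0 \<le> u" "0 \<le> v" "0 \<le> a" "0 \<le> b" "a + b = 1"
  shows "(a * u + b * v) powr q \<le> a * u powr q + b * v powr q"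
proof -
  have small: "c powr q \<le> c" if "0 \<le> c" "c \<le> 1" for c
    using that assms(1) powr_mono' [of 1 q c] by (cases "c = 0") auto
  have one: "(c * w) powr q \<le> c * w powr q" if "0 \<le> w" "0 \<le> c" "c \<le> 1" for w c
    using that small [of c] by (simp add: powr_mult mult_right_mono)
  show ?thesis
  proof (cases "u = 0 \<or> v = 0")
    case True
    then show ?thesis using assms one [of v b] one [of u a] by auto
  next
    case False
    moreover have a: "a = 1 - b" using assms(6) by simp
    ultimately show ?thesis
      using convex_onD [OF powr_convex [OF assms(1)], of b u v] assms(2-5) unfolding a by simp
  qed
qed

lemma lp_norm_finite_powr:
  assumes "1 \<le> p" "p \<noteq> \<infinity>"
  shows "lp_norm p x powr real_of_ereal p = (\<Sum>i\<in>UNIV. \<bar>x $ i\<bar> powr real_of_ereal p)"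
proof -
  have "1 \<le> real_of_ereal p" using assms by (cases p) auto
  then show ?thesis using assms by (simp add: lp_norm_def powr_powr sum_nonneg)
qed

lemma lp_norm_nonneg: "0 \<le> lp_norm p x"
proof -
  have "\<bar>x $ undefined\<bar> \<le> (MAX i. \<bar>x $ i\<bar>)" by (rule Max_ge) auto
  then have "0 \<le> (MAX i. \<bar>x $ i\<bar>)" by linarith
  then show ?thesis by (simp add: lp_norm_def)
qed

lemma component_le_lp_norm:
  assumes "1 \<le> p"
  shows "\<bar>x $ i\<bar> \<le> lp_norm p x"
proof (cases "p = \<infinity>")
  case True
  then show ?thesis by (simp add: lp_norm_def)
next
  case False
  define q where "q = real_of_ereal p"
  have q: "1 \<le> q" using assms False unfolding q_def by (cases p) auto
  have "\<bar>x $ i\<bar> powr q \<le> (\<Sum>i\<in>UNIV. \<bar>x $ i\<bar> powr q)"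
    by (rule member_le_sum) auto
  also have "\<dots> = lp_norm p x powr q"
    unfolding q_def by (rule lp_norm_finite_powr [OF assms False, symmetric])
  finally show ?thesis
    using q lp_norm_nonneg powr_less_mono2 [of q "lp_norm p x" "\<bar>x $ i\<bar>"] by force
qed

lemma lp_norm_minus: "lp_norm p (- x) = lp_norm p x"
  by (simp add: lp_norm_def)

lemma lp_norm_commute: "lp_norm p (x - y) = lp_norm p (y - x)"
  using lp_norm_minus [of p "x - y"] by simp

lemma lp_norm_zero: "1 \<le> p \<Longrightarrow> lp_norm p 0 = 0"
  by (simp add: lp_norm_def)

lemma lp_norm_eq_0D:
  assumes "1 \<le> p" "lp_norm p x = 0"
  shows "x = 0"
  using component_le_lp_norm [OF assms(1), of x] assms(2) by (simp add: vec_eq_iff)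

text \<open>Minkowski's inequality from convexity of the power. With \<open>A\<close>,
  \<open>B\<close> the two norms and \<open>C = A + B\<close>, each \<bar>x + y\<bar> / C is at most
  the convex combination of \<bar>x\<bar> / A and \<bar>y\<bar> / B with weights A / C and B / C;
  summing the powers over the coordinates gives 1 on the right.\<close>

lemma lp_norm_triangle:
  assumes "1 \<le> p"
  shows "lp_norm p (x + y) \<le> lp_norm p x + lp_norm p y"
proof (cases "p = \<infinity>")
  case True
  have "\<bar>(x + y) $ i\<bar> \<le> lp_norm p x + lp_norm p y" for i
    using component_le_lp_norm [OF assms, of x i] component_le_lp_norm [OF assms, of y i] by simp
  moreover have "lp_norm p (x + y) = (MAX i. \<bar>(x + y) $ i\<bar>)" using True by (simp add: lp_norm_def)
  ultimately show ?thesis by (simp del: vector_add_component)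
next
  case False
  define q where "q = real_of_ereal p"
  define A B where "A = lp_norm p x" and "B = lp_norm p y"
  have q: "1 \<le> q" using assms False unfolding q_def by (cases p) auto
  have AB: "0 \<le> A" "0 \<le> B" by (simp_all add: A_def B_def lp_norm_nonneg)
  have pw: "lp_norm p z powr q = (\<Sum>i\<in>UNIV. \<bar>z $ i\<bar> powr q)" for z :: "real ^ 'a"
    using lp_norm_finite_powr [OF assms False] by (simp add: q_def)
  show ?thesis
  proof (cases "A = 0 \<or> B = 0")
    case True
    then show ?thesis
      using lp_norm_eq_0D [OF assms, of x] lp_norm_eq_0D [OF assms, of y] lp_norm_zero [OF assms]
      by (auto simp: A_def B_def)
  next
    case nz: False
    define C where "C = A + B"
    have pos: "0 < A" "0 < B" "0 < C" using AB nz by (auto simp: C_def)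
    have "\<bar>(x + y) $ i\<bar> powr q
        \<le> C powr q * (A / C * (\<bar>x $ i\<bar> powr q / A powr q) + B / C * (\<bar>y $ i\<bar> powr q / B powr q))" for i
    proof -
      have "\<bar>(x + y) $ i\<bar> \<le> C * (A / C * (\<bar>x $ i\<bar> / A) + B / C * (\<bar>y $ i\<bar> / B))"
        using pos abs_triangle_ineq by (simp add: distrib_left)
      then have "\<bar>(x + y) $ i\<bar> powr q \<le> (C * (A / C * (\<bar>x $ i\<bar> / A) + B / C * (\<bar>y $ i\<bar> / B))) powr q"
        using q by (intro powr_mono2) auto
      also have "\<dots> = C powr q * (A / C * (\<bar>x $ i\<bar> / A) + B / C * (\<bar>y $ i\<bar> / B)) powr q"
        by (rule powr_mult)
      also have "\<dots> \<le> C powr q * (A / C * (\<bar>x $ i\<bar> / A) powr q + B / C * (\<bar>y $ i\<bar> / B) powr q)"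
        using pos by (intro mult_left_mono powr_convex_nonneg q) (auto simp: add_divide_distrib [symmetric] C_def)
      finally show ?thesis using pos by (simp add: powr_divide)
    qed
    then have "lp_norm p (x + y) powr q
        \<le> (\<Sum>i\<in>UNIV. C powr q * (A / C * (\<bar>x $ i\<bar> powr q / A powr q) + B / C * (\<bar>y $ i\<bar> powr q / B powr q)))"
      unfolding pw by (rule sum_mono)
    also have "\<dots> = C powr q * (A / C * ((\<Sum>i\<in>UNIV. \<bar>x $ i\<bar> powr q) / A powr q)
        + B / C * ((\<Sum>i\<in>UNIV. \<bar>y $ i\<bar> powr q) / B powr q))"
      by (simp add: sum.distrib sum_distrib_left [symmetric] sum_divide_distrib [symmetric])
    also have "\<dots> = C powr q * (A / C + B / C)"
      unfolding pw [symmetric] using pos by (simp add: A_def B_def)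
    also have "\<dots> = C powr q"
      using pos by (simp add: C_def add_divide_distrib [symmetric])
    finally have "lp_norm p (x + y) \<le> C"
      using q pos powr_less_mono2 [of q C "lp_norm p (x + y)"] by force
    then show ?thesis by (simp add: C_def A_def B_def)
  qed
qed

lemma lp_norm_triangle_diff:
  assumes "1 \<le> p"
  shows "lp_norm p (x - z) \<le> lp_norm p (x - y) + lp_norm p (y - z)"
  using lp_norm_triangle [OF assms, of "x - y" "y - z"] by simp

lemma continuous_on_lp_norm:
  fixes S :: "(real ^ 'n) set"
  assumes "1 \<le> p"
  shows "continuous_on S (lp_norm p)"
proof (cases "p = \<infinity>")
  case True
  have "continuous_map euclidean euclideanreal (\<lambda>x :: real ^ 'n. MAX i. \<bar>x $ i\<bar>)"
    by (rule continuous_map_Max) (auto intro!: continuous_intros)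
  moreover have "lp_norm p = (\<lambda>x :: real ^ 'n. MAX i. \<bar>x $ i\<bar>)"
    using True by (auto simp: lp_norm_def)
  ultimately have "continuous_on UNIV (lp_norm p :: real ^ 'n \<Rightarrow> real)"
    by simp
  then show ?thesis by (rule continuous_on_subset) simp
next
  case False
  then have q: "1 \<le> real_of_ereal p" using assms by (cases p) auto
  have "lp_norm p = (\<lambda>x :: real ^ 'n. (\<Sum>i\<in>UNIV. \<bar>x $ i\<bar> powr real_of_ereal p) powr (1 / real_of_ereal p))"
    using False by (auto simp: lp_norm_def)
  then show ?thesis using q by (auto intro!: continuous_intros continuous_on_powr' sum_nonneg)
qed

lemma norm_le_lp_norm:
  fixes x :: "real ^ 'n"
  assumes "1 \<le> p"
  shows "norm x \<le> CARD('n) * lp_norm p x"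
proof -
  have "norm x \<le> (\<Sum>i\<in>UNIV. \<bar>x $ i\<bar>)" by (rule norm_le_l1_cart)
  also have "\<dots> \<le> (\<Sum>i\<in>(UNIV :: 'n set). lp_norm p x)"
    by (intro sum_mono component_le_lp_norm assms)
  finally show ?thesis by simp
qed

text \<open>Common points at radii decreasing to the limit stay bounded, and a convergent
  subsequence ends in a common point at the limit. This gives right-continuity of the filtrations,
  so that entry times are attained.\<close>

lemma lp_balls_meet_at_limit:
  fixes c :: "'i \<Rightarrow> real ^ 'n" and R :: "'i \<Rightarrow> real \<Rightarrow> real"
  assumes p: "1 \<le> p" and R: "\<And>i. continuous_on UNIV (R i)" and \<sigma>: "\<sigma> \<noteq> {}"
    and meet: "\<And>s. r < s \<Longrightarrow> \<exists>y. \<forall>i\<in>\<sigma>. lp_norm p (c i - y) \<le> R i s"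
  shows "\<exists>y. \<forall>i\<in>\<sigma>. lp_norm p (c i - y) \<le> R i r"
proof -
  have "\<forall>k. \<exists>y. \<forall>i\<in>\<sigma>. lp_norm p (c i - y) \<le> R i (r + 1 / Suc k)"
    by (intro allI meet) simp
  then obtain y :: "nat \<Rightarrow> real ^ 'n"
    where y: "\<And>k i. i \<in> \<sigma> \<Longrightarrow> lp_norm p (c i - y k) \<le> R i (r + 1 / Suc k)"
    by metis
  have lim: "(\<lambda>k. R i (r + 1 / Suc k)) \<longlonglongrightarrow> R i r" for i
  proof -
    have "(\<lambda>k. r + 1 / Suc k) \<longlonglongrightarrow> r + 0"
      by (intro tendsto_intros LIMSEQ_Suc lim_1_over_n)
    then show ?thesis
      using R [of i] continuous_on_tendsto_compose [of UNIV "R i" "\<lambda>k. r + 1 / Suc k" r] by simp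
  qed
  obtain i0 where i0: "i0 \<in> \<sigma>" using \<sigma> by blast
  obtain B where B: "\<And>k. R i0 (r + 1 / Suc k) \<le> B"
  proof -
    have "Bseq (\<lambda>k. R i0 (r + 1 / Suc k))"
      using lim convergentI convergent_imp_Bseq by blast
    then obtain B where "\<And>k. norm (R i0 (r + 1 / Suc k)) \<le> B" by (auto simp: Bseq_def)
    then have "R i0 (r + 1 / Suc k) \<le> B" for k
      using abs_le_D1 by (metis real_norm_def)
    then show thesis by (rule that)
  qed
  have "bounded (range y)"
  proof (rule boundedI)
    fix z assume "z \<in> range y"
    then obtain k where k: "z = y k" by blast
    have "norm (c i0 - y k) \<le> CARD('n) * lp_norm p (c i0 - y k)" by (rule norm_le_lp_norm [OF p])
    also have "\<dots> \<le> CARD('n) * B"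
      using y [OF i0, of k] B [of k] by (intro mult_left_mono) auto
    finally show "norm z \<le> norm (c i0) + CARD('n) * B"
      using k norm_triangle_sub [of "y k" "c i0"] by (simp add: norm_minus_commute)
  qed
  then obtain l s where s: "strict_mono (s :: nat \<Rightarrow> nat)" "(y \<circ> s) \<longlonglongrightarrow> l"
    using bounded_imp_convergent_subsequence by blast
  have "lp_norm p (c i - l) \<le> R i r" if "i \<in> \<sigma>" for i
  proof (rule LIMSEQ_le)
    have "(\<lambda>k. c i - (y \<circ> s) k) \<longlonglongrightarrow> c i - l" by (intro tendsto_intros s)
    then show "(\<lambda>k. lp_norm p (c i - (y \<circ> s) k)) \<longlonglongrightarrow> lp_norm p (c i - l)"
      using continuous_on_tendsto_compose [OF continuous_on_lp_norm [OF p, of UNIV]] by simp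
    show "(\<lambda>k. R i (r + 1 / Suc (s k))) \<longlonglongrightarrow> R i r"
      using LIMSEQ_subseq_LIMSEQ [OF lim s(1)] by (simp add: o_def)
    show "\<exists>N. \<forall>k\<ge>N. lp_norm p (c i - (y \<circ> s) k) \<le> R i (r + 1 / Suc (s k))"
      using y [OF that] by auto
  qed
  then show ?thesis by blast
qed

section \<open>The capped Cech filtration\<close>

lemma mem_nerve_iff:
  "\<sigma> \<in> nerve S V \<longleftrightarrow> \<sigma> \<noteq> {} \<and> finite \<sigma> \<and> \<sigma> \<subseteq> S \<and> (\<exists>y. \<forall>s\<in>\<sigma>. y \<in> V s)"
  by (auto simp: nerve_def)

lemma nerve_mono:
  assumes "\<And>s. V s \<subseteq> W s"
  shows "nerve S V \<subseteq> nerve S W"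
proof
  fix \<sigma> assume "\<sigma> \<in> nerve S V"
  then show "\<sigma> \<in> nerve S W" using subsetD [OF assms] unfolding mem_nerve_iff by meson
qed

lemma finite_complex_nerve:
  assumes "finite S"
  shows "finite_complex (nerve S V)"
proof -
  have "nerve S V \<subseteq> Pow S" by (auto simp: nerve_def)
  then have "finite (nerve S V)" using assms by (meson finite_Pow_iff finite_subset)
  moreover have "\<tau> \<in> nerve S V" if "\<sigma> \<in> nerve S V" "\<tau> \<subseteq> \<sigma>" "\<tau> \<noteq> {}" for \<sigma> \<tau>
    using that finite_subset [OF that(2)] unfolding mem_nerve_iff by blast
  moreover have "finite \<sigma> \<and> \<sigma> \<noteq> {}" if "\<sigma> \<in> nerve S V" for \<sigma>
    using that by (simp add: mem_nerve_iff)
  ultimately show ?thesis unfolding finite_complex_def by meson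
qed

lemma finite_complex_initial:
  assumes "finite_complex K"
  shows "finite_complex {\<sigma> \<in> K. \<sigma> \<subseteq> A}"
  using assms unfolding finite_complex_def by (simp, meson order_trans)

text \<open>Seen from \<open>K\<close>, the vertices go in decreasing order. When \<open>i\<close>
  is removed only simplices inside \<open>{1..i}\<close> are left, which is why domination is asked
  for those alone and by a vertex smaller than \<open>i\<close>.\<close>

lemma homotopy_equivalence_initial_complex:
  fixes K :: "nat set set"
  assumes K: "finite_complex K" "K \<subseteq> Pow {1..m}" and "k \<le> m"
    and dom: "\<And>i. k < i \<Longrightarrow> i \<le> m \<Longrightarrow>
      \<exists>j<i. \<forall>\<sigma>\<in>K. i \<in> \<sigma> \<longrightarrow> \<sigma> \<subseteq> {1..i} \<longrightarrow> insert j \<sigma> \<in> K"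
  shows "homotopy_equivalence_map (realization {\<sigma> \<in> K. \<sigma> \<subseteq> {1..k}}) (realization K) (\<lambda>t. t)"
proof -
  have "homotopy_equivalence_map (realization {\<sigma> \<in> K. \<sigma> \<subseteq> {1..k}})
      (realization {\<sigma> \<in> K. \<sigma> \<subseteq> {1..n}}) (\<lambda>t. t)" if "k \<le> n" "n \<le> m" for n
    using that
  proof (induction n rule: dec_induct)
    case base
    show ?case
      by (rule homotopy_equivalence_map_homeomorphic) (simp add: homeomorphic_map_id [unfolded id_def])
  next
    case (step n)
    obtain j where j: "j < Suc n"
      "\<And>\<sigma>. \<sigma> \<in> K \<Longrightarrow> Suc n \<in> \<sigma> \<Longrightarrow> \<sigma> \<subseteq> {1..Suc n} \<Longrightarrow> insert j \<sigma> \<in> K"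
      using dom [of "Suc n"] step by auto
    let ?L = "{\<sigma> \<in> K. \<sigma> \<subseteq> {1..Suc n}}"
    have "homotopy_equivalence_map (realization {\<sigma> \<in> ?L. Suc n \<notin> \<sigma>}) (realization ?L) (\<lambda>t. t)"
    proof (rule homotopy_equivalence_dominated_vertex)
      show "finite_complex ?L" by (rule finite_complex_initial [OF K(1)])
      show "Suc n \<noteq> j" using j by simp
      show "insert j \<sigma> \<in> ?L" if "\<sigma> \<in> ?L" "Suc n \<in> \<sigma>" for \<sigma>
      proof -
        have "insert j \<sigma> \<in> K" using that by (intro j(2)) auto
        moreover from this have "1 \<le> j" using K(2) by (auto dest: subsetD)
        ultimately show ?thesis using that(1) j(1) by auto
      qed
    qed
    moreover have "{\<sigma> \<in> ?L. Suc n \<notin> \<sigma>} = {\<sigma> \<in> K. \<sigma> \<subseteq> {1..n}}"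
      by (auto simp: subset_iff le_Suc_eq)
    ultimately have *: "homotopy_equivalence_map (realization {\<sigma> \<in> K. \<sigma> \<subseteq> {1..n}}) (realization ?L) (\<lambda>t. t)"
      by simp
    have "n \<le> m" using step by simp
    from homotopy_equivalence_map_compose [OF step.IH [OF this] *] show ?case by (simp add: o_def)
  qed
  moreover have "{\<sigma> \<in> K. \<sigma> \<subseteq> {1..m}} = K" using K(2) by blast
  ultimately show ?thesis using \<open>k \<le> m\<close> by fastforce
qed

locale greedy_sparsification =
  fixes p :: ereal and \<epsilon> :: real and P :: "(real ^ 'n) set" and m :: nat and pt :: "nat \<Rightarrow> real ^ 'n"
  assumes p: "1 \<le> p" and eps: "0 < \<epsilon>" and greedy: "greedy_permutation p P m pt"
begin

abbreviation ptdist :: "nat \<Rightarrow> real ^ 'n \<Rightarrow> real" where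
  "ptdist i y \<equiv> lp_norm p (pt i - y)"

text \<open>The insertion radius as a real number, meaningful from index 2 on. At index 1 the
  minimum is over the empty set, so the uses of \<open>freeze\<close> below treat that index
  separately.\<close>

definition separation :: "nat \<Rightarrow> real" where
  "separation i = (MIN j\<in>{1..<i}. ptdist i (pt j))"

definition freeze :: "nat \<Rightarrow> real" where
  "freeze i = separation i * (1 + \<epsilon>) / \<epsilon>"

lemma pt_bij: "bij_betw pt {1..m} P"
  using greedy by (simp add: greedy_permutation_def)

lemma separation_attained:
  assumes "2 \<le> i"
  obtains j where "1 \<le> j" "j < i" "separation i = ptdist i (pt j)"
proof -
  have "separation i \<in> (\<lambda>j. ptdist i (pt j)) ` {1..<i}"
    unfolding separation_def using assms by (intro Min_in) auto
  then show ?thesis using that by auto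
qed

text \<open>The form in which the furthest-point choice is used: since \<open>pt i\<close> is
  furthest from its predecessors, no point of \<open>P\<close> is further from them than
  \<open>separation i\<close>.\<close>

lemma covered_by_earlier:
  assumes "2 \<le> i" "i \<le> m" "1 \<le> l" "l \<le> m"
  obtains j where "1 \<le> j" "j < i" "lp_norm p (pt l - pt j) \<le> separation i"
proof -
  have "pt l \<in> P" using pt_bij assms by (auto simp: bij_betw_def)
  then have "(MIN j\<in>{1..<i}. lp_norm p (pt l - pt j)) \<le> separation i"
    using greedy assms by (auto simp: greedy_permutation_def separation_def)
  moreover have "(MIN j\<in>{1..<i}. lp_norm p (pt l - pt j)) \<in> (\<lambda>j. lp_norm p (pt l - pt j)) ` {1..<i}"
    using assms by (intro Min_in) auto
  ultimately show ?thesis using that by auto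
qed

lemma separation_antimono:
  assumes "2 \<le> i" "i \<le> l" "l \<le> m"
  shows "separation l \<le> separation i"
proof (cases "i = l")
  case False
  obtain j where j: "1 \<le> j" "j < i" "lp_norm p (pt l - pt j) \<le> separation i"
    using covered_by_earlier [of i l] assms by auto
  have "separation l \<le> lp_norm p (pt l - pt j)"
    unfolding separation_def using j assms by (intro Min_le) auto
  with j show ?thesis by simp
qed auto

lemma freeze_antimono:
  assumes "2 \<le> i" "i \<le> l" "l \<le> m"
  shows "freeze l \<le> freeze i"
  unfolding freeze_def using separation_antimono [OF assms] eps
  by (intro divide_right_mono mult_right_mono) auto

lemma separation_pos:
  assumes "2 \<le> i" "i \<le> m"
  shows "0 < separation i"
proof -
  obtain j where j: "1 \<le> j" "j < i" "separation i = ptdist i (pt j)"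
    using separation_attained [OF assms(1)] .
  have "pt i \<noteq> pt j"
    using inj_onD [OF bij_betw_imp_inj_on [OF pt_bij], of i j] j assms by auto
  then have "ptdist i (pt j) \<noteq> 0" using lp_norm_eq_0D [OF p] by fastforce
  then show ?thesis using j lp_norm_nonneg [of p "pt i - pt j"] by simp
qed

lemma freeze_pos: "2 \<le> i \<Longrightarrow> i \<le> m \<Longrightarrow> 0 < freeze i"
  using separation_pos eps by (simp add: freeze_def)

lemma mem_sparse_ball:
  assumes "1 \<le> i" "i \<le> m"
  shows "y \<in> sparse_ball p \<epsilon> pt i q \<longleftrightarrow> 0 \<le> q \<and>
    (if i = 1 then ptdist i y \<le> q else q \<le> freeze i * (1 + \<epsilon>) \<and> ptdist i y \<le> min q (freeze i))"
proof (cases "i = 1")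
  case True
  then show ?thesis using eps
    by (simp add: sparse_ball_def insertion_radius_def lp_ball_def)
next
  case False
  then have f: "0 < freeze i" using freeze_pos assms by simp
  define T where "T = freeze i * (1 + \<epsilon>)"
  have "insertion_radius p pt i * ereal ((1 + \<epsilon>) / \<epsilon>) = ereal (freeze i)"
    "insertion_radius p pt i * ereal ((1 + \<epsilon>)\<^sup>2 / \<epsilon>) = ereal T"
    using False by (simp_all add: T_def insertion_radius_def freeze_def separation_def power2_eq_square)
  moreover have "freeze i \<le> T" using f eps by (simp add: T_def mult_le_cancel_left1)
  ultimately show ?thesis
    using False f unfolding T_def [symmetric] by (auto simp: sparse_ball_def lp_ball_def Let_def)
qed

text \<open>Three phases: full growth up to \<open>freeze i\<close>, rest until
  \<open>r = freeze i * (1 + \<epsilon>)\<close>, where the sparse ball disappears, and from then on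
  growth with slope \<open>1 / (1 + \<epsilon>)\<close> in place of disappearance. The first ball
  never freezes.\<close>

definition capped_radius :: "nat \<Rightarrow> real \<Rightarrow> real" where
  "capped_radius i r = (if i = 1 then r else max (r / (1 + \<epsilon>)) (min r (freeze i)))"

definition capped_cech :: "real \<Rightarrow> nat set set" where
  "capped_cech r = nerve {1..m} (\<lambda>i. {y. ptdist i y \<le> capped_radius i r})"

text \<open>On indices, so that the comparison with the capped and sparse complexes is a matter of
  literal inclusions.\<close>

definition indexed_cech :: "real \<Rightarrow> nat set set" where
  "indexed_cech r = nerve {1..m} (\<lambda>i. {y. ptdist i y \<le> r})"

section \<open>Interleaving and right-continuity of the capped and the full Cech complexes\<close>

lemma capped_radius_mono: "r \<le> s \<Longrightarrow> capped_radius i r \<le> capped_radius i s"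
  using eps divide_right_mono [of r s "1 + \<epsilon>"] by (auto simp: capped_radius_def)

lemma capped_radius_le: "0 \<le> r \<Longrightarrow> capped_radius i r \<le> r"
  using eps by (auto simp: capped_radius_def pos_divide_le_eq mult_le_cancel_left1)

lemma capped_radius_ge: "0 \<le> r \<Longrightarrow> r / (1 + \<epsilon>) \<le> capped_radius i r"
  using eps divide_left_mono [of 1 "1 + \<epsilon>" r] by (auto simp: capped_radius_def)

lemma capped_cech_mono: "r \<le> s \<Longrightarrow> capped_cech r \<subseteq> capped_cech s"
  unfolding capped_cech_def by (rule nerve_mono) (use capped_radius_mono order_trans in blast)

lemma indexed_cech_mono: "r \<le> s \<Longrightarrow> indexed_cech r \<subseteq> indexed_cech s"
  unfolding indexed_cech_def by (rule nerve_mono) auto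

lemma capped_cech_subset: "0 \<le> r \<Longrightarrow> capped_cech r \<subseteq> indexed_cech r"
  unfolding capped_cech_def indexed_cech_def
  by (rule nerve_mono) (use capped_radius_le order_trans in blast)

lemma indexed_cech_subset: "0 \<le> r \<Longrightarrow> indexed_cech r \<subseteq> capped_cech (r * (1 + \<epsilon>))"
  unfolding capped_cech_def indexed_cech_def
proof (rule nerve_mono, safe)
  fix i y assume "0 \<le> r" "ptdist i y \<le> r"
  moreover have "r \<le> capped_radius i (r * (1 + \<epsilon>))" if "0 \<le> r"
    using capped_radius_ge [of "r * (1 + \<epsilon>)" i] eps that by simp
  ultimately show "ptdist i y \<le> capped_radius i (r * (1 + \<epsilon>))" by linarith
qed

lemma cech_eq_indexed: "cech p P r = (`) pt ` indexed_cech r"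
proof -
  have inj: "inj_on pt {1..m}" and P: "P = pt ` {1..m}" using pt_bij by (auto simp: bij_betw_def)
  show ?thesis
  proof (intro equalityI subsetI)
    fix \<sigma> assume "\<sigma> \<in> cech p P r"
    then obtain y where \<sigma>: "\<sigma> \<noteq> {}" "finite \<sigma>" "\<sigma> \<subseteq> pt ` {1..m}" "\<And>s. s \<in> \<sigma> \<Longrightarrow> lp_norm p (s - y) \<le> r"
      by (auto simp: cech_def mem_nerve_iff lp_ball_def P)
    then obtain \<tau> where \<tau>: "\<tau> \<subseteq> {1..m}" "\<sigma> = pt ` \<tau>" by (auto simp: subset_image_iff)
    moreover have "\<forall>i\<in>\<tau>. ptdist i y \<le> r" using \<sigma>(4) \<tau>(2) by blast
    ultimately have "\<tau> \<in> indexed_cech r"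
      using \<sigma>(1) finite_subset [OF \<tau>(1)] unfolding indexed_cech_def mem_nerve_iff by blast
    then show "\<sigma> \<in> (`) pt ` indexed_cech r" using \<tau> by blast
  next
    fix \<sigma> assume "\<sigma> \<in> (`) pt ` indexed_cech r"
    then obtain \<tau> where \<sigma>: "\<sigma> = pt ` \<tau>" and \<tau>: "\<tau> \<in> indexed_cech r" by (rule imageE)
    then obtain y where "\<tau> \<noteq> {}" "finite \<tau>" "\<tau> \<subseteq> {1..m}" and y: "\<forall>i\<in>\<tau>. ptdist i y \<le> r"
      unfolding indexed_cech_def mem_nerve_iff by auto
    moreover have "\<forall>s\<in>\<sigma>. y \<in> lp_ball p s (ereal r)"
      using y \<sigma> by (simp add: lp_ball_def)
    ultimately show "\<sigma> \<in> cech p P r"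
      unfolding cech_def mem_nerve_iff P \<sigma> by (intro conjI image_mono exI [of _ y] finite_imageI) auto
  qed
qed

lemma capped_cech_right_closed:
  assumes "\<And>s. r < s \<Longrightarrow> \<sigma> \<in> capped_cech s"
  shows "\<sigma> \<in> capped_cech r"
proof -
  have c: "continuous_on UNIV (capped_radius i)" for i
    using eps unfolding capped_radius_def by (cases "i = 1") (auto intro!: continuous_intros)
  have \<sigma>: "\<sigma> \<noteq> {}" "finite \<sigma>" "\<sigma> \<subseteq> {1..m}"
    using assms [of "r + 1"] by (simp_all add: capped_cech_def mem_nerve_iff)
  have meet: "\<exists>y. \<forall>i\<in>\<sigma>. ptdist i y \<le> capped_radius i s" if "r < s" for s
    using assms [OF that] by (simp add: capped_cech_def mem_nerve_iff)
  have "\<exists>y. \<forall>i\<in>\<sigma>. ptdist i y \<le> capped_radius i r"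
    by (rule lp_balls_meet_at_limit [OF p c \<sigma>(1)]) (rule meet)
  then show ?thesis using \<sigma> by (simp add: capped_cech_def mem_nerve_iff)
qed

lemma indexed_cech_right_closed:
  assumes "\<And>s. r < s \<Longrightarrow> \<sigma> \<in> indexed_cech s"
  shows "\<sigma> \<in> indexed_cech r"
proof -
  have \<sigma>: "\<sigma> \<noteq> {}" "finite \<sigma>" "\<sigma> \<subseteq> {1..m}"
    using assms [of "r + 1"] by (simp_all add: indexed_cech_def mem_nerve_iff)
  have meet: "\<exists>y. \<forall>i\<in>\<sigma>. ptdist i y \<le> s" if "r < s" for s
    using assms [OF that] by (simp add: indexed_cech_def mem_nerve_iff)
  have "\<exists>y. \<forall>i\<in>\<sigma>. ptdist i y \<le> r"
    by (rule lp_balls_meet_at_limit [OF p continuous_on_id \<sigma>(1)]) (rule meet)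
  then show ?thesis using \<sigma> by (simp add: indexed_cech_def mem_nerve_iff)
qed

lemma eventually_indexed_cech:
  assumes "\<sigma> \<noteq> {}" "\<sigma> \<subseteq> {1..m}"
  obtains r where "0 < r" "\<sigma> \<in> indexed_cech r"
proof -
  \<comment> \<open>At this radius all the balls contain the origin. The summand 1 makes the radius
    positive, so that it has a logarithm.\<close>
  define r where "r = 1 + (\<Sum>i\<in>\<sigma>. ptdist i 0)"
  have fin: "finite \<sigma>" using assms finite_subset by blast
  have "ptdist i 0 \<le> r" if "i \<in> \<sigma>" for i
    using member_le_sum [OF that, of "\<lambda>i. ptdist i 0"] fin by (simp add: r_def lp_norm_nonneg)
  then have "\<sigma> \<in> indexed_cech r" using fin assms unfolding indexed_cech_def mem_nerve_iff by blast
  moreover have "0 < r"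
    by (simp add: r_def lp_norm_nonneg sum_nonneg add_pos_nonneg)
  ultimately show ?thesis using that by blast
qed

text \<open>A common point of the covers carries a time coordinate, so all balls of a simplex meet
  at one and the same time \<open>q\<close>. A simplex is recorded then and persists after its balls
  have disappeared.\<close>

lemma mem_sparse_filtration:
  "\<sigma> \<in> sparse_filtration p \<epsilon> m pt r \<longleftrightarrow> \<sigma> \<noteq> {} \<and> \<sigma> \<subseteq> {1..m} \<and>
    (\<exists>y q. 0 \<le> q \<and> q \<le> r \<and> (\<forall>i\<in>\<sigma>. y \<in> sparse_ball p \<epsilon> pt i q))"
  unfolding sparse_filtration_def mem_nerve_iff sparse_cover_def
  by (auto intro: finite_subset)

lemma sparse_subset_capped: "sparse_filtration p \<epsilon> m pt r \<subseteq> capped_cech r"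
proof
  fix \<sigma> assume "\<sigma> \<in> sparse_filtration p \<epsilon> m pt r"
  then obtain y q where \<sigma>: "\<sigma> \<noteq> {}" "\<sigma> \<subseteq> {1..m}" "0 \<le> q" "q \<le> r"
      "\<And>i. i \<in> \<sigma> \<Longrightarrow> y \<in> sparse_ball p \<epsilon> pt i q"
    by (auto simp: mem_sparse_filtration)
  have "ptdist i y \<le> capped_radius i r" if "i \<in> \<sigma>" for i
  proof -
    have "1 \<le> i" "i \<le> m" using \<sigma> that by auto
    from mem_sparse_ball [OF this, of y q] \<sigma>(5) [OF that] \<sigma>(4)
    show ?thesis by (auto simp: capped_radius_def split: if_splits)
  qed
  then show "\<sigma> \<in> capped_cech r"
    using \<sigma>(1,2) finite_subset [OF \<sigma>(2)] unfolding capped_cech_def mem_nerve_iff by blast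
qed

section \<open>Removal of the vertices whose sparse balls have disappeared\<close>

definition present :: "nat \<Rightarrow> real \<Rightarrow> bool" where
  "present i r \<longleftrightarrow> i = 1 \<or> r \<le> freeze i * (1 + \<epsilon>)"

lemma close_to_unfrozen:
  assumes i: "2 \<le> i" "i \<le> m" and r: "freeze i < r"
  obtains j where "1 \<le> j" "j < i" "j = 1 \<or> r \<le> freeze j"
    "lp_norm p (pt j - pt i) \<le> r * (\<epsilon> / (1 + \<epsilon>))"
proof -
  \<comment> \<open>The insertion radius of the first frozen vertex bounds the distance of every point to the
    vertices before it.\<close>
  define k where "k = (LEAST k. 2 \<le> k \<and> freeze k < r)"
  have k: "2 \<le> k" "freeze k < r" "k \<le> i"
    unfolding k_def using LeastI [of "\<lambda>k. 2 \<le> k \<and> freeze k < r" i] i r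
      Least_le [of "\<lambda>k. 2 \<le> k \<and> freeze k < r" i] by auto
  have min: "j = 1 \<or> r \<le> freeze j" if "1 \<le> j" "j < k" for j
    using not_less_Least [OF that(2) [unfolded k_def]] that(1) by auto
  obtain j where j: "1 \<le> j" "j < k" "lp_norm p (pt i - pt j) \<le> separation k"
    using covered_by_earlier [of k i] k i by auto
  have "separation k = freeze k * (\<epsilon> / (1 + \<epsilon>))" using eps by (simp add: freeze_def)
  also have "\<dots> \<le> r * (\<epsilon> / (1 + \<epsilon>))" using k eps by (intro mult_right_mono) auto
  finally have "lp_norm p (pt j - pt i) \<le> r * (\<epsilon> / (1 + \<epsilon>))"
    using j(3) lp_norm_commute [of p "pt i"] by simp
  then show ?thesis using that j k min by auto
qed

text \<open>The ball of a vertex that is no longer present has radius exactly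
  \<open>r / (1 + \<epsilon>)\<close>. A nearby unfrozen vertex is at distance at most
  \<open>r * (\<epsilon> / (1 + \<epsilon>))\<close>, the two add up to \<open>r\<close>, and so its
  ball contains the first one.\<close>

lemma capped_cech_dominated:
  assumes r: "0 < r" and i: "1 \<le> i" "i \<le> m" "\<not> present i r"
  shows "\<exists>j<i. \<forall>\<sigma>\<in>capped_cech r. i \<in> \<sigma> \<longrightarrow> insert j \<sigma> \<in> capped_cech r"
proof -
  have i2: "2 \<le> i" and f: "freeze i * (1 + \<epsilon>) < r" using i by (auto simp: present_def)
  have f': "freeze i < r / (1 + \<epsilon>)" using f eps by (simp add: pos_less_divide_eq)
  then have "freeze i < r" using r eps by (smt (verit) divide_le_eq_1 le_divide_eq_1 mult_less_cancel_left2 freeze_pos i2 i(2) f mult.commute)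
  then obtain j where j: "1 \<le> j" "j < i" "j = 1 \<or> r \<le> freeze j"
      "lp_norm p (pt j - pt i) \<le> r * (\<epsilon> / (1 + \<epsilon>))"
    using close_to_unfrozen i2 i(2) by blast
  have "ptdist j y \<le> capped_radius j r" if y: "ptdist i y \<le> capped_radius i r" for y
  proof -
    have "capped_radius i r = r / (1 + \<epsilon>)" using f' i2 by (auto simp: capped_radius_def)
    then have "ptdist j y \<le> r * (\<epsilon> / (1 + \<epsilon>)) + r / (1 + \<epsilon>)"
      using lp_norm_triangle_diff [OF p, of "pt j" y "pt i"] j(4) y by simp
    also have "\<dots> = r" using eps by (simp add: add_divide_distrib [symmetric] divide_eq_eq distrib_left)
    also have "r \<le> capped_radius j r" using j(3) by (auto simp: capped_radius_def)
    finally show ?thesis .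
  qed
  note j_near = this
  have "insert j \<sigma> \<in> capped_cech r" if \<sigma>: "\<sigma> \<in> capped_cech r" "i \<in> \<sigma>" for \<sigma>
  proof -
    obtain y where y: "\<And>l. l \<in> \<sigma> \<Longrightarrow> ptdist l y \<le> capped_radius l r" and "finite \<sigma>" "\<sigma> \<subseteq> {1..m}"
      using \<sigma>(1) by (auto simp: capped_cech_def mem_nerve_iff)
    moreover have "ptdist j y \<le> capped_radius j r" by (rule j_near [OF y [OF \<sigma>(2)]])
    moreover have "j \<in> {1..m}" using j i by simp
    ultimately show ?thesis
      unfolding capped_cech_def mem_nerve_iff by (intro conjI exI [of _ y]) auto
  qed
  then show ?thesis using j(2) by blast
qed

text \<open>A simplex at \<open>i\<close> whose other vertices outlive \<open>i\<close> survives until \<open>i\<close> disappears, and at that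
  time the ball of a nearby unfrozen vertex contains the frozen ball of \<open>i\<close>.\<close>

lemma sparse_filtration_dominated:
  assumes r: "0 < r" and i: "1 \<le> i" "i \<le> m" "\<not> present i r"
  shows "\<exists>j<i. \<forall>\<sigma>\<in>sparse_filtration p \<epsilon> m pt r. i \<in> \<sigma> \<longrightarrow> \<sigma> \<subseteq> {1..i} \<longrightarrow>
    insert j \<sigma> \<in> sparse_filtration p \<epsilon> m pt r"
proof -
  define T where "T = freeze i * (1 + \<epsilon>)"
  have i2: "2 \<le> i" and T: "T < r" using i by (auto simp: present_def T_def)
  have f: "0 < freeze i" using freeze_pos i2 i by blast
  then have fT: "freeze i < T" using eps by (simp add: T_def)
  then obtain j where j: "1 \<le> j" "j < i" "j = 1 \<or> T \<le> freeze j"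
      "lp_norm p (pt j - pt i) \<le> T * (\<epsilon> / (1 + \<epsilon>))"
    using close_to_unfrozen i2 i(2) by blast
  have "insert j \<sigma> \<in> sparse_filtration p \<epsilon> m pt r"
    if \<sigma>: "\<sigma> \<in> sparse_filtration p \<epsilon> m pt r" "i \<in> \<sigma>" "\<sigma> \<subseteq> {1..i}" for \<sigma>
  proof -
    obtain y q where y: "0 \<le> q" "q \<le> r" "\<And>l. l \<in> \<sigma> \<Longrightarrow> y \<in> sparse_ball p \<epsilon> pt l q"
      using \<sigma>(1) unfolding mem_sparse_filtration by blast
    have yi: "q \<le> T" "ptdist i y \<le> freeze i"
      using y(3) [OF \<sigma>(2)] i i2 by (auto simp: mem_sparse_ball T_def)
    \<comment> \<open>The witness moves from time \<open>q\<close> to \<open>T\<close>. Here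
      \<open>q \<le> T\<close> because the ball of \<open>i\<close> is nonempty at \<open>q\<close>;
      every \<open>l \<le> i\<close> has a freezing radius at least that of \<open>i\<close>, so it
      is still present at \<open>T\<close>, with a ball that has not shrunk.\<close>
    have "y \<in> sparse_ball p \<epsilon> pt l T" if l: "l \<in> \<sigma>" for l
    proof -
      have l1: "1 \<le> l" "l \<le> i" "l \<le> m" using l \<sigma> i by auto
      show ?thesis
      proof (cases "l = 1")
        case True
        then show ?thesis using y(3) [OF l] l1 yi y(1) by (auto simp: mem_sparse_ball)
      next
        case False
        then have "T \<le> freeze l * (1 + \<epsilon>)"
          unfolding T_def using freeze_antimono [of l i] l1 i eps by (intro mult_right_mono) auto
        then show ?thesis using y(3) [OF l] l1 yi y(1) False by (auto simp: mem_sparse_ball)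
      qed
    qed
    moreover have "y \<in> sparse_ball p \<epsilon> pt j T"
    proof -
      have "ptdist j y \<le> T * (\<epsilon> / (1 + \<epsilon>)) + freeze i"
        using lp_norm_triangle_diff [OF p, of "pt j" y "pt i"] j(4) yi by simp
      also have "\<dots> = T" using eps by (simp add: T_def field_simps)
      finally have "ptdist j y \<le> T" .
      moreover have "T \<le> freeze j * (1 + \<epsilon>)" if "j \<noteq> 1"
      proof -
        have "0 \<le> freeze j" using j(3) that f fT by simp
        then have "freeze j \<le> freeze j * (1 + \<epsilon>)" using eps by (simp add: mult_le_cancel_left1)
        then show ?thesis using j(3) that by simp
      qed
      ultimately show ?thesis using j i f fT by (auto simp: mem_sparse_ball)
    qed
    ultimately show ?thesis
      using \<sigma>(1) j i T f fT unfolding mem_sparse_filtration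
      by (intro conjI exI [of _ y] exI [of _ T]) auto
  qed
  with j(2) show ?thesis by blast
qed

text \<open>For a present vertex the lower bound \<open>r / (1 + \<epsilon>)\<close> does not exceed
  \<open>min r (freeze i)\<close>, so the capped ball is the sparse ball at time \<open>r\<close>,
  and a common point of the capped balls is a sparse witness with \<open>q = r\<close>.\<close>

lemma present_agree:
  assumes r: "0 < r" and k: "k \<le> m" "\<And>i. 1 \<le> i \<Longrightarrow> i \<le> k \<Longrightarrow> present i r"
  shows "{\<sigma> \<in> capped_cech r. \<sigma> \<subseteq> {1..k}} = {\<sigma> \<in> sparse_filtration p \<epsilon> m pt r. \<sigma> \<subseteq> {1..k}}"
proof -
  have "\<sigma> \<in> sparse_filtration p \<epsilon> m pt r" if \<sigma>: "\<sigma> \<in> capped_cech r" "\<sigma> \<subseteq> {1..k}" for \<sigma>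
  proof -
    obtain y where y: "\<sigma> \<noteq> {}" "\<sigma> \<subseteq> {1..m}" "\<And>i. i \<in> \<sigma> \<Longrightarrow> ptdist i y \<le> capped_radius i r"
      using \<sigma> by (auto simp: capped_cech_def mem_nerve_iff)
    have "y \<in> sparse_ball p \<epsilon> pt i r" if "i \<in> \<sigma>" for i
    proof -
      have i: "1 \<le> i" "i \<le> m" "present i r" using that \<sigma> k by auto
      show ?thesis
      proof (cases "i = 1")
        case False
        then have "r \<le> freeze i * (1 + \<epsilon>)" using i by (simp add: present_def)
        then have "r / (1 + \<epsilon>) \<le> freeze i" "r / (1 + \<epsilon>) \<le> r"
          using eps r by (simp_all add: pos_divide_le_eq mult_le_cancel_left1)
        then show ?thesis using y(3) [OF that] i r False by (auto simp: mem_sparse_ball capped_radius_def present_def)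
      qed (use y(3) [OF that] i r in \<open>auto simp: mem_sparse_ball capped_radius_def\<close>)
    qed
    then show ?thesis
      using y(1,2) r unfolding mem_sparse_filtration by (intro conjI exI [of _ y] exI [of _ r]) auto
  qed
  then show ?thesis using sparse_subset_capped by blast
qed

theorem sparse_inclusion_homotopy_equivalence:
  assumes r: "0 < r"
  shows "homotopy_equivalence_map (realization (sparse_filtration p \<epsilon> m pt r))
    (realization (capped_cech r)) (\<lambda>t. t)"
proof -
  let ?S = "sparse_filtration p \<epsilon> m pt r" and ?E = "capped_cech r"
  \<comment> \<open>The last present vertex; the inserted 0 gives a value when \<open>P\<close> is
    empty.\<close>
  define k where "k = Max (insert 0 {i \<in> {1..m}. present i r})"
  have km: "k \<le> m" unfolding k_def by (subst Max_le_iff) auto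
  have above: "\<not> present i r" if "k < i" "i \<le> m" for i
  proof
    assume "present i r"
    then have "i \<le> k" unfolding k_def using that by (intro Max_ge) auto
    with that show False by simp
  qed
  \<comment> \<open>Freezing radii decrease along the greedy order, so the present vertices form an
    initial segment.\<close>
  have below: "present i r" if "1 \<le> i" "i \<le> k" for i
  proof (cases "i = 1")
    case False
    have "k \<in> insert 0 {i \<in> {1..m}. present i r}" unfolding k_def by (rule Max_in) auto
    then have "present k r" "2 \<le> k" using that False by auto
    then have "r \<le> freeze k * (1 + \<epsilon>)" by (auto simp: present_def)
    also have "\<dots> \<le> freeze i * (1 + \<epsilon>)"
      using freeze_antimono [of i k] that False km eps by (intro mult_right_mono) auto
    finally show ?thesis by (simp add: present_def)
  qed (simp add: present_def)
  have fin: "finite_complex ?S" "finite_complex ?E"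
    by (auto simp: sparse_filtration_def capped_cech_def intro: finite_complex_nerve)
  have sub: "?S \<subseteq> Pow {1..m}" "?E \<subseteq> Pow {1..m}"
    unfolding mem_sparse_filtration capped_cech_def nerve_def subset_iff Pow_iff by simp_all
  have S: "homotopy_equivalence_map (realization {\<sigma> \<in> ?S. \<sigma> \<subseteq> {1..k}}) (realization ?S) (\<lambda>t. t)"
    using above
    by (intro homotopy_equivalence_initial_complex [OF fin(1) sub(1) km] sparse_filtration_dominated [OF r]) auto
  have E: "homotopy_equivalence_map (realization {\<sigma> \<in> ?E. \<sigma> \<subseteq> {1..k}}) (realization ?E) (\<lambda>t. t)"
  proof (rule homotopy_equivalence_initial_complex [OF fin(2) sub(2) km])
    show "\<exists>j<i. \<forall>\<sigma>\<in>?E. i \<in> \<sigma> \<longrightarrow> \<sigma> \<subseteq> {1..i} \<longrightarrow> insert j \<sigma> \<in> ?E" if "k < i" "i \<le> m" for i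
      using capped_cech_dominated [OF r _ that(2)] above [OF that] that(1) by (metis Suc_leI le0 le_less_trans One_nat_def)
  qed
  have "continuous_map (realization ?S) (realization ?E) (\<lambda>t. t)"
    using fin sparse_subset_capped by (intro continuous_map_realization_inclusion) (auto simp: finite_complex_def)
  \<comment> \<open>The equivalence \<open>E\<close> starts from the same complex as
    \<open>S\<close> and factors through the inclusion in question.\<close>
  then show ?thesis
    using homotopy_equivalence_map_cancel_right [OF S] E present_agree [OF r km below]
    by (simp add: o_def)
qed

end

section \<open>Filtered complexes as sublevel sets\<close>

lemma homotopy_equivalence_map_fst:
  fixes I :: "real set"
  assumes "convex I" "c \<in> I"
  shows "homotopy_equivalence_map (top_of_set (A \<times> I)) (top_of_set A) fst"
  unfolding homotopy_equivalence_map_def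
proof (intro conjI exI [of _ "\<lambda>t. (t, c)"])
  show "continuous_map (top_of_set (A \<times> I)) (top_of_set A) fst"
    by (auto intro!: continuous_intros)
  show "continuous_map (top_of_set A) (top_of_set (A \<times> I)) (\<lambda>t. (t, c))"
    using assms by (auto intro!: continuous_intros)
  show "homotopic_with (\<lambda>_. True) (top_of_set A) (top_of_set A) id (fst \<circ> (\<lambda>t. (t, c)))"
    by (simp add: o_def id_def)
  let ?H = "\<lambda>z. (fst (snd z), (1 - fst z) * snd (snd z) + fst z * c)"
  have "continuous_on ({0..1} \<times> A \<times> I) ?H" by (intro continuous_intros)
  moreover have "?H z \<in> A \<times> I" if "z \<in> {0..1} \<times> A \<times> I" for z
    using that convexD_alt [OF assms(1), of "snd (snd z)" c "fst z"] assms(2) by auto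
  ultimately show "homotopic_with (\<lambda>_. True) (top_of_set (A \<times> I)) (top_of_set (A \<times> I)) id ((\<lambda>t. (t, c)) \<circ> fst)"
    unfolding homotopic_with_def
    by (intro exI [of _ ?H]) (auto simp: prod_topology_subtopology_eu)
qed

text \<open>Equivalences arise naturally with a realization \<open>Q\<close> as target, over a type
  of barycentric coordinates. Composing with the inverse of the isomorphism from \<open>R'\<close>
  keeps the step inside the universe of the distance.\<close>

lemma weakly_equivalent_step_via_isomorphic:
  fixes R R' :: "'u rspace"
  assumes R: "is_rspace R" and R': "is_rspace R'"
    and h: "natural_map R Q h" "\<And>x. homotopy_equivalence_map (obj R x) (obj Q x) (h x)"
    and iso: "rspace_isomorphic R' Q"
  shows "weakly_equivalent_step R R'"
proof -
  obtain f where f: "natural_map R' Q f" "\<And>x. homeomorphic_map (obj R' x) (obj Q x) (f x)"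
    using iso unfolding rspace_isomorphic_def by blast
  have "\<forall>x. \<exists>g. homeomorphic_maps (obj R' x) (obj Q x) (f x) g"
    using f(2) homeomorphic_map_maps by blast
  then obtain g where g: "\<And>x. homeomorphic_maps (obj R' x) (obj Q x) (f x) (g x)"
    by metis
  then have gc: "continuous_map (obj Q x) (obj R' x) (g x)"
    and fg: "\<And>z. z \<in> topspace (obj Q x) \<Longrightarrow> f x (g x z) = z"
    and gf: "\<And>z. z \<in> topspace (obj R' x) \<Longrightarrow> g x (f x z) = z" for x
    by (simp_all add: homeomorphic_maps_def)
  have g_in: "g x z \<in> topspace (obj R' x)" if "z \<in> topspace (obj Q x)" for x z
    using gc [of x] that by (auto simp: continuous_map_def)
  have h_in: "h x z \<in> topspace (obj Q x)" if "z \<in> topspace (obj R x)" for x z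
    using h(1) that unfolding natural_map_def continuous_map_def by fast
  have arr_in: "arr R' x y z \<in> topspace (obj R' y)" if "z \<in> topspace (obj R' x)" "x \<le> y" for x y z
    using R' that unfolding is_rspace_def continuous_map_def by fast
  have he: "homotopy_equivalence_map (obj R x) (obj R' x) (g x \<circ> h x)" for x
  proof -
    have "homeomorphic_maps (obj Q x) (obj R' x) (g x) (f x)"
      using g homeomorphic_maps_sym by blast
    then have "homeomorphic_map (obj Q x) (obj R' x) (g x)"
      using homeomorphic_map_maps by blast
    then show ?thesis
      by (intro homotopy_equivalence_map_compose [OF h(2)] homotopy_equivalence_map_homeomorphic)
  qed
  have "natural_map R R' (\<lambda>x. g x \<circ> h x)"
    unfolding natural_map_def
  proof (intro conjI allI impI ballI)
    show "continuous_map (obj R x) (obj R' x) (g x \<circ> h x)" for x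
      using he homotopy_equivalence_map_def by blast
    fix x y z assume xy: "x \<le> y" and z: "z \<in> topspace (obj R x)"
    \<comment> \<open>Naturality of the inverse is checked after applying \<open>f y\<close>, and
      \<open>g y\<close> then cancels it.\<close>
    have "f y (arr R' x y (g x (h x z))) = arr Q x y (f x (g x (h x z)))"
      using f(1) xy g_in [OF h_in [OF z]] by (simp add: natural_map_def)
    also have "\<dots> = h y (arr R x y z)"
      using h(1) xy z fg [OF h_in [OF z]] by (simp add: natural_map_def)
    finally have "h y (arr R x y z) = f y (arr R' x y (g x (h x z)))" by simp
    then show "(g y \<circ> h y) (arr R x y z) = arr R' x y ((g x \<circ> h x) z)"
      using gf [OF arr_in [OF g_in [OF h_in [OF z]] xy]] by simp
  qed
  then show ?thesis
    unfolding weakly_equivalent_step_def using R R' he homotopy_equivalence_imp_weak by blast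
qed

lemma homotopy_invariant_distance_step:
  assumes "homotopy_invariant_distance d" "weakly_equivalent_step R R'"
  shows "d R R' = 0" "d R' R = 0"
proof -
  have "weakly_equivalent R R'" "weakly_equivalent R' R" "is_rspace R" "is_rspace R'"
    using assms(2) unfolding weakly_equivalent_def
    by (simp_all add: r_into_equivclp equivclp_sym) (simp_all add: weakly_equivalent_step_def)
  then show "d R R' = 0" "d R' R = 0"
    using assms(1) by (auto simp: homotopy_invariant_distance_def)
qed

text \<open>Besides monotonicity, right-continuity makes an entry time a minimum, and the eventual
  appearance of every simplex makes it finite.\<close>

definition filtered_complex :: "nat \<Rightarrow> (real \<Rightarrow> nat set set) \<Rightarrow> bool" where
  "filtered_complex m F \<longleftrightarrow>
     (\<forall>x. finite_complex (F x) \<and> F x \<subseteq> Pow {1..m}) \<and> (\<forall>x y. x \<le> y \<longrightarrow> F x \<subseteq> F y) \<and>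
     (\<forall>x \<sigma>. (\<forall>y>x. \<sigma> \<in> F y) \<longrightarrow> \<sigma> \<in> F x) \<and>
     (\<forall>\<sigma>. \<sigma> \<noteq> {} \<longrightarrow> \<sigma> \<subseteq> {1..m} \<longrightarrow> (\<exists>x. \<sigma> \<in> F x))"

lemma filtered_complexD:
  assumes "filtered_complex m F"
  shows "finite_complex (F x)" "F x \<subseteq> Pow {1..m}" "x \<le> y \<Longrightarrow> F x \<subseteq> F y"
    "(\<And>y. x < y \<Longrightarrow> \<sigma> \<in> F y) \<Longrightarrow> \<sigma> \<in> F x"
    "\<sigma> \<noteq> {} \<Longrightarrow> \<sigma> \<subseteq> {1..m} \<Longrightarrow> \<exists>x. \<sigma> \<in> F x"
  using assms unfolding filtered_complex_def by simp_all

text \<open>Vertices may be present at all times; the line coordinate keeps the infimum from being taken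
  over a set that is unbounded below.\<close>

definition entry_time :: "(real \<Rightarrow> nat set set) \<Rightarrow> (nat \<Rightarrow> real) \<times> real \<Rightarrow> real" where
  "entry_time F z = Inf {x. snd z \<le> x \<and> {v. fst z v \<noteq> 0} \<in> F x}"

text \<open>The sublevel set at \<open>x\<close> is the carrier of \<open>F x\<close> times the
  half-line up to \<open>x\<close>. The set of admissible times is nonempty, bounded below by the
  line coordinate and upward closed, and right-continuity puts its infimum into it.\<close>

lemma entry_time_le_iff:
  assumes F: "filtered_complex m F" and z: "fst z \<in> closed_simplex {1..m}"
  shows "entry_time F z \<le> x \<longleftrightarrow> snd z \<le> x \<and> fst z \<in> geometric_carrier (F x)"
proof -
  let ?\<sigma> = "{v. fst z v \<noteq> 0}" and ?A = "{x. snd z \<le> x \<and> {v. fst z v \<noteq> 0} \<in> F x}"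
  have pos: "\<And>v. 0 \<le> fst z v" and sub: "?\<sigma> \<subseteq> {1..m}" and s: "sum (fst z) {1..m} = 1"
    using z by (auto simp: closed_simplex_def)
  have s': "sum (fst z) ?\<sigma> = 1"
    unfolding s [symmetric] using sub by (intro sum.mono_neutral_left) simp_all
  then have ne: "?\<sigma> \<noteq> {}" by (metis sum.empty zero_neq_one)
  have carrier: "fst z \<in> geometric_carrier (F x) \<longleftrightarrow> ?\<sigma> \<in> F x"
    using pos s' mem_geometric_carrier [OF filtered_complexD(1) [OF F], of "fst z"] by simp
  obtain x0 where x0: "?\<sigma> \<in> F x0" using filtered_complexD(5) [OF F ne sub] ..
  have up: "y \<in> ?A" if "x \<in> ?A" "x \<le> y" for x y
    using that filtered_complexD(3) [OF F that(2)] by auto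
  have "?A \<noteq> {}"
  proof -
    have "max x0 (snd z) \<in> ?A" using x0 filtered_complexD(3) [OF F, of x0 "max x0 (snd z)"] by auto
    then show ?thesis by blast
  qed
  have bdd: "bdd_below ?A" by (rule bdd_belowI [of _ "snd z"]) simp
  have "entry_time F z \<le> x \<longleftrightarrow> x \<in> ?A"
  proof
    assume le: "entry_time F z \<le> x"
    have gt: "y \<in> ?A" if "x < y" for y
    proof -
      have "Inf ?A < y" using le that by (simp add: entry_time_def)
      then obtain a where "a \<in> ?A" "a < y" using cInf_lessD [OF \<open>?A \<noteq> {}\<close>] by blast
      then show ?thesis using up [of a y] by simp
    qed
    have later: "snd z \<le> y" "?\<sigma> \<in> F y" if "x < y" for y using gt [OF that] by simp_all
    have "snd z \<le> x" by (rule dense_ge) (rule later)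
    moreover have "?\<sigma> \<in> F x" by (rule filtered_complexD(4) [OF F]) (rule later)
    ultimately show "x \<in> ?A" by simp
  next
    assume "x \<in> ?A"
    then show "entry_time F z \<le> x" unfolding entry_time_def by (rule cInf_lower [OF _ bdd])
  qed
  then show ?thesis using carrier by simp
qed

text \<open>Each inclusion carries an admissible time for one filtration to one for the other. The
  line coordinate is the same in both, and a nonnegative shift preserves its bound.\<close>

lemma entry_time_interleaved:
  assumes F: "filtered_complex m F" and G: "filtered_complex m G" and z: "fst z \<in> closed_simplex {1..m}"
    and FG: "\<And>x. F x \<subseteq> G x" "\<And>x. G x \<subseteq> F (x + \<delta>)" and "0 \<le> \<delta>"
  shows "\<bar>entry_time F z - entry_time G z\<bar> \<le> \<delta>"
proof -
  note iffF = entry_time_le_iff [OF F z] and iffG = entry_time_le_iff [OF G z]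
  have "entry_time G z \<le> entry_time F z"
    using iffF [of "entry_time F z"] iffG [of "entry_time F z"] geometric_carrier_mono [OF FG(1)] by blast
  moreover have "entry_time F z \<le> entry_time G z + \<delta>"
    using iffG [of "entry_time G z"] iffF [of "entry_time G z + \<delta>"] geometric_carrier_mono [OF FG(2)] \<open>0 \<le> \<delta>\<close>
    by fastforce
  ultimately show ?thesis by simp
qed

text \<open>Stability compares two functions on one space, so a single copy of the cylinder over the
  full simplex has to carry the entry times of both filtrations.\<close>

locale embedded_cylinder =
  fixes m :: nat and e :: "(nat \<Rightarrow> real) \<times> real \<Rightarrow> 'u"
  assumes e: "inj_on e (closed_simplex {1..m} \<times> UNIV)"
begin

abbreviation cylinder :: "((nat \<Rightarrow> real) \<times> real) set" where
  "cylinder \<equiv> closed_simplex {1..m} \<times> UNIV"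

definition ambient :: "'u topology" where
  "ambient = relabelled_topology e (top_of_set cylinder)"

definition pos :: "'u \<Rightarrow> (nat \<Rightarrow> real) \<times> real" where
  "pos = inv_into cylinder e"

lemma pos_e: "z \<in> cylinder \<Longrightarrow> pos (e z) = z"
  unfolding pos_def using e by (rule inv_into_f_f)

lemma homeomorphic_ambient: "homeomorphic_map (top_of_set cylinder) ambient e"
  unfolding ambient_def by (rule homeomorphic_map_relabelled) (use e in simp)

lemma topspace_ambient: "topspace ambient = e ` cylinder"
  using homeomorphic_imp_surjective_map [OF homeomorphic_ambient] by simp

section \<open>Point-set topology of the cylinder and its closed parts\<close>

lemma cylinder_topology:
  "Hausdorff_space (top_of_set cylinder)" "locally_compact_space (top_of_set cylinder)"
proof -
  let ?D = "top_of_set (closed_simplex {1..m})"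
  have eq: "top_of_set cylinder = prod_topology ?D euclideanreal"
    using prod_topology_subtopology_eu [of "closed_simplex {1..m}" "UNIV :: real set"] by simp
  show "Hausdorff_space (top_of_set cylinder)"
    unfolding eq by (auto simp: Hausdorff_space_prod_topology Hausdorff_space_euclidean
        intro: Hausdorff_space_subtopology Hausdorff_space_function_space)
  have "compact_space ?D"
    by (simp add: compact_space_subtopology closed_simplex_compact)
  then show "locally_compact_space (top_of_set cylinder)"
    unfolding eq by (simp add: locally_compact_space_prod_topology
        compact_imp_locally_compact_space locally_compact_space_euclidean)
qed

lemma Hausdorff_ambient: "Hausdorff_space ambient"
  using homeomorphic_Hausdorff_space [OF homeomorphic_map_imp_homeomorphic_space [OF homeomorphic_ambient]]
    cylinder_topology(1) by simp

lemma k_space_ambient: "k_space ambient"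
proof -
  have "k_space (top_of_set cylinder)"
    by (rule locally_compact_imp_k_space [OF cylinder_topology(2)])
  then show ?thesis
    using homeomorphic_k_space [OF homeomorphic_map_imp_homeomorphic_space [OF homeomorphic_ambient]] by simp
qed

lemma cgwh_ambient: "cgwh ambient"
  by (intro cgwh_k_space k_space_ambient Hausdorff_ambient)

lemma homeomorphic_part:
  assumes "W \<subseteq> cylinder"
  shows "homeomorphic_map (subtopology ambient (e ` W)) (top_of_set W) pos"
proof -
  have "homeomorphic_maps (top_of_set cylinder) ambient e pos"
  proof -
    obtain g where g: "homeomorphic_maps (top_of_set cylinder) ambient e g"
      using homeomorphic_ambient homeomorphic_map_maps by blast
    then show ?thesis
      by (rule homeomorphic_maps_eq) (use g in \<open>auto simp: topspace_ambient pos_e homeomorphic_maps_def\<close>)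
  qed
  then have "homeomorphic_maps ambient (top_of_set cylinder) pos e"
    by (rule homeomorphic_maps_sym [THEN iffD1])
  then have "homeomorphic_map ambient (top_of_set cylinder) pos"
    using homeomorphic_map_maps by blast
  moreover have "pos ` (topspace ambient \<inter> e ` W) = topspace (top_of_set cylinder) \<inter> W"
    using assms by (force simp: topspace_ambient pos_e)
  ultimately have "homeomorphic_map (subtopology ambient (e ` W)) (subtopology (top_of_set cylinder) W) pos"
    by (rule homeomorphic_map_subtopologies)
  then show ?thesis using assms by (simp add: subtopology_subtopology Int_absorb1)
qed

text \<open>Closed subspaces inherit the k-space property. All parts used below are closed, so their
  subspace topology is already compactly generated.\<close>

lemma part_k_space:
  assumes "W \<subseteq> cylinder" "closedin (top_of_set cylinder) W"
  shows "k_space (subtopology ambient (e ` W))" "Hausdorff_space (subtopology ambient (e ` W))"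
proof -
  have "closedin ambient (e ` W)"
    using assms homeomorphic_map_closedness_eq [OF homeomorphic_ambient] by simp
  then show "k_space (subtopology ambient (e ` W))"
    using k_space_ambient k_space_closed_subtopology by blast
qed (rule Hausdorff_space_subtopology [OF Hausdorff_ambient])

text \<open>Two choices of \<open>I\<close> matter: \<open>{0}\<close> gives a copy of the realized
  filtration inside the universe, and \<open>{..x}\<close> gives the sublevel filtration of the
  entry time. Both project to the realization.\<close>

definition slab :: "(real \<Rightarrow> nat set set) \<Rightarrow> (real \<Rightarrow> real set) \<Rightarrow> 'u rspace" where
  "slab F I = \<lparr> obj = (\<lambda>x. subtopology ambient (e ` (geometric_carrier (F x) \<times> I x))), arr = (\<lambda>r s x. x) \<rparr>"

lemma carrier_subset:
  assumes "filtered_complex m F"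
  shows "geometric_carrier (F x) \<times> I \<subseteq> cylinder"
proof -
  have "t \<in> closed_simplex {1..m}" if t: "t \<in> geometric_carrier (F x)" for t
  proof -
    obtain \<sigma> where \<sigma>: "\<sigma> \<in> F x" "t \<in> closed_simplex \<sigma>" using t by (auto simp: geometric_carrier_def)
    then have sub: "\<sigma> \<subseteq> {1..m}" using filtered_complexD(2) [OF assms] by blast
    have "sum t \<sigma> = sum t {1..m}"
      using \<sigma>(2) sub by (intro sum.mono_neutral_left) (auto simp: closed_simplex_def)
    then show ?thesis using \<sigma>(2) sub by (auto simp: closed_simplex_def)
  qed
  then show ?thesis by blast
qed

lemma carrier_closed:
  assumes "filtered_complex m F" "closed I"
  shows "closedin (top_of_set cylinder) (geometric_carrier (F x) \<times> I)"
proof -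
  have "finite (F x)" using filtered_complexD(1) [OF assms(1)] by (simp add: finite_complex_def)
  then have "closed (geometric_carrier (F x))"
    unfolding geometric_carrier_def by (intro closed_UN ballI closed_simplex_closed)
  then have "closed (geometric_carrier (F x) \<times> I)" using assms(2) by (rule closed_Times)
  then show ?thesis using carrier_subset [OF assms(1)] by (intro closed_subset) auto
qed

lemma is_rspace_slab:
  assumes F: "filtered_complex m F" and I: "\<And>x. closed (I x)" "\<And>x y. x \<le> y \<Longrightarrow> I x \<subseteq> I y"
  shows "is_rspace (slab F I)"
proof -
  have "cgwh (subtopology ambient (e ` (geometric_carrier (F x) \<times> I x)))" for x
    by (intro cgwh_k_space part_k_space carrier_subset carrier_closed F I)
  moreover have "continuous_map (subtopology ambient (e ` (geometric_carrier (F x) \<times> I x)))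
      (subtopology ambient (e ` (geometric_carrier (F y) \<times> I y))) (\<lambda>u. u)" if "x \<le> y" for x y
  proof -
    have "e ` (geometric_carrier (F x) \<times> I x) \<subseteq> e ` (geometric_carrier (F y) \<times> I y)"
      by (intro image_mono Sigma_mono geometric_carrier_mono filtered_complexD(3) [OF F] I(2) that)
    then show ?thesis
      by (auto simp: continuous_map_in_subtopology intro: continuous_map_from_subtopology)
  qed
  ultimately show ?thesis by (simp add: is_rspace_def slab_def)
qed

lemma homotopy_equivalence_slab:
  assumes F: "filtered_complex m F" and I: "convex (I x)" "c \<in> I x"
  shows "homotopy_equivalence_map (obj (slab F I) x) (realization (F x)) (fst \<circ> pos)"
proof -
  have "finite (F x)" using filtered_complexD(1) [OF F] by (simp add: finite_complex_def)
  then show ?thesis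
    unfolding slab_def using homeomorphic_part [OF carrier_subset [OF F]] homotopy_equivalence_map_fst [OF I]
    by (auto simp: realization_finite intro: homotopy_equivalence_map_compose homotopy_equivalence_map_homeomorphic)
qed

lemma natural_map_slab:
  assumes F: "filtered_complex m F" and I: "\<And>x. convex (I x)" "\<And>x. I x \<noteq> {}"
  shows "natural_map (slab F I) (realization_rspace F) (\<lambda>x. fst \<circ> pos)"
proof -
  have "continuous_map (obj (slab F I) x) (realization (F x)) (fst \<circ> pos)" for x
  proof -
    obtain c where "c \<in> I x" using I(2) by blast
    then show ?thesis
      using homotopy_equivalence_slab [OF F, of I x c] I(1) by (simp add: homotopy_equivalence_map_def)
  qed
  then show ?thesis by (simp add: natural_map_def realization_rspace_def slab_def)
qed

lemma isomorphic_slab: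
  assumes F: "filtered_complex m F"
  shows "rspace_isomorphic (slab F (\<lambda>_. {0})) (realization_rspace F)"
proof -
  have "homeomorphic_map (obj (slab F (\<lambda>_. {0})) x) (realization (F x)) (fst \<circ> pos)" for x
  proof -
    let ?C = "geometric_carrier (F x)"
    have "homeomorphic_maps (top_of_set (?C \<times> {0::real})) (top_of_set ?C) fst (\<lambda>t. (t, 0))"
      by (auto simp: homeomorphic_maps_def
          intro!: continuous_on_fst continuous_on_Pair continuous_on_id continuous_on_const)
    then have "homeomorphic_map (top_of_set (?C \<times> {0::real})) (top_of_set ?C) fst"
      using homeomorphic_map_maps by blast
    from homeomorphic_map_compose [OF homeomorphic_part [OF carrier_subset [OF F]] this]
    show ?thesis
      using filtered_complexD(1) [OF F] by (simp add: slab_def realization_finite finite_complex_def)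
  qed
  then show ?thesis
    unfolding rspace_isomorphic_def
    using natural_map_slab [OF F, of "\<lambda>_. {0}"] by (auto simp: realization_rspace_def)
qed

lemma sublevel_eq_slab:
  assumes F: "filtered_complex m F"
  shows "sublevel_rspace ambient (entry_time F \<circ> pos) = slab F (\<lambda>x. {..x})"
proof -
  have "{u \<in> topspace ambient. (entry_time F \<circ> pos) u \<le> x} = e ` (geometric_carrier (F x) \<times> {..x})" for x
  proof -
    have "{u \<in> topspace ambient. (entry_time F \<circ> pos) u \<le> x} = e ` {z \<in> cylinder. entry_time F z \<le> x}"
      by (auto simp: topspace_ambient pos_e)
    also have "{z \<in> cylinder. entry_time F z \<le> x} = geometric_carrier (F x) \<times> {..x}"
    proof (intro equalityI subsetI)
      fix z assume z: "z \<in> {z \<in> cylinder. entry_time F z \<le> x}"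
      then have "fst z \<in> closed_simplex {1..m}" by auto
      then show "z \<in> geometric_carrier (F x) \<times> {..x}"
        using z entry_time_le_iff [OF F, of z x] by (cases z) simp
    next
      fix z assume z: "z \<in> geometric_carrier (F x) \<times> {..x}"
      then have "z \<in> cylinder" using carrier_subset [OF F] by blast
      moreover from this have "fst z \<in> closed_simplex {1..m}" by auto
      ultimately show "z \<in> {z \<in> cylinder. entry_time F z \<le> x}"
        using z entry_time_le_iff [OF F, of z x] by (cases z) simp
    qed
    finally show ?thesis .
  qed
  moreover have "kify (subtopology ambient (e ` (geometric_carrier (F x) \<times> {..x})))
      = subtopology ambient (e ` (geometric_carrier (F x) \<times> {..x}))" for x
    by (intro kify_compactly_generated compactly_generated_k_space part_k_space
        carrier_subset carrier_closed F closed_atMost)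
  ultimately show ?thesis by (simp add: sublevel_rspace_def slab_def)
qed

end

section \<open>The distance bound\<close>

lemma inj_sequences_into_reals: "\<exists>f :: (nat \<Rightarrow> real) \<Rightarrow> real. inj f"
proof -
  obtain a :: "real \<Rightarrow> nat set" and b :: "nat set \<Rightarrow> real" where "inj a" "inj b"
    using nat_sets_eqpoll_reals by (meson eqpoll_imp_lepoll eqpoll_sym lepoll_def)
  \<comment> \<open>Reals are coded by sets of naturals, and a sequence of such sets is a single set
    of pairs, hence again a set of naturals.\<close>
  let ?c = "\<lambda>t. prod_encode ` (SIGMA i:UNIV. a (t i))"
  have "inj ?c"
  proof (rule injI)
    fix s t assume "?c s = ?c t"
    then have "(SIGMA i:UNIV. a (s i)) = (SIGMA i:UNIV. a (t i))"
      by (rule inj_image_eq_iff [OF inj_prod_encode, THEN iffD1])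
    then have "a (s i) = a (t i)" for i by (simp add: set_eq_iff)
    then show "s = t" using injD [OF \<open>inj a\<close>] by (intro ext) simp
  qed
  then have "inj (b \<circ> ?c)" using \<open>inj b\<close> by (intro inj_compose)
  then show ?thesis by blast
qed

lemma inj_cylinder:
  fixes \<phi> :: "real \<Rightarrow> 'u"
  assumes "inj_on \<phi> {0..1}"
  shows "\<exists>e :: (nat \<Rightarrow> real) \<times> real \<Rightarrow> 'u. inj e"
proof -
  obtain f :: "(nat \<Rightarrow> real) \<Rightarrow> real" where f: "inj f" using inj_sequences_into_reals by blast
  obtain c :: "real \<Rightarrow> real" where c: "inj c" "range c \<subseteq> {0..1}"
    using closed_interval_eqpoll_reals [of 0 1] by (metis eqpoll_imp_lepoll eqpoll_sym lepoll_def zero_less_one)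
  \<comment> \<open>The line coordinate is prepended to the sequence as its term 0.\<close>
  have "inj (\<lambda>(t, s). case_nat s t :: nat \<Rightarrow> real)"
  proof (rule injI, clarify)
    fix t t' :: "nat \<Rightarrow> real" and s s' assume "case_nat s t = case_nat s' t'"
    then have "case_nat s t i = case_nat s' t' i" for i by simp
    from this [of 0] this [of "Suc i" for i] show "t = t' \<and> s = s'" by auto
  qed
  then have "inj (f \<circ> (\<lambda>(t, s). case_nat s t))" by (rule inj_compose [OF f])
  moreover have "inj (\<phi> \<circ> c)" using assms c by (metis comp_inj_on inj_on_subset)
  ultimately have "inj ((\<phi> \<circ> c) \<circ> (f \<circ> (\<lambda>(t, s). case_nat s t)))"
    by (intro inj_compose [of "\<phi> \<circ> c"])
  then show ?thesis by blast
qed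

lemma inj_on_edge:
  assumes "i \<noteq> j"
  shows "inj_on (\<lambda>s v. if v = i then s else if v = j then 1 - s else 0 :: real) {0..1}"
    "(\<lambda>s v. if v = i then s else if v = j then 1 - s else 0) ` {0..1} \<subseteq> closed_simplex {i, j}"
  using assms by (auto simp: inj_on_def closed_simplex_def fun_eq_iff split: if_splits)

lemma nerve_cong:
  assumes "\<And>s. s \<in> S \<Longrightarrow> V s = W s"
  shows "nerve S V = nerve S W"
  unfolding nerve_def using assms
  by (intro Collect_cong conj_cong refl) (metis INF_cong subsetD)

context greedy_sparsification
begin

section \<open>The Cech and capped filtrations in logarithmic scale\<close>

lemma filtered_complex_indexed_cech: "filtered_complex m (\<lambda>x. indexed_cech (2 powr x))"
  unfolding filtered_complex_def
proof (intro conjI allI impI)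
  show "finite_complex (indexed_cech (2 powr x))" for x
    unfolding indexed_cech_def by (rule finite_complex_nerve) simp
  show "indexed_cech (2 powr x) \<subseteq> Pow {1..m}" for x
    by (auto simp: indexed_cech_def nerve_def)
  show "indexed_cech (2 powr x) \<subseteq> indexed_cech (2 powr y)" if "x \<le> y" for x y
    using that by (intro indexed_cech_mono) simp
  show "\<sigma> \<in> indexed_cech (2 powr x)" if later: "\<forall>y>x. \<sigma> \<in> indexed_cech (2 powr y)" for x \<sigma>
  proof (rule indexed_cech_right_closed)
    fix s assume s: "2 powr x < s"
    have "0 < s" using s powr_ge_zero [of 2 x] by linarith
    moreover from this s have "x < log 2 s" by (simp add: less_log_iff)
    ultimately show "\<sigma> \<in> indexed_cech s" using later [rule_format, of "log 2 s"] by simp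
  qed
  show "\<exists>x. \<sigma> \<in> indexed_cech (2 powr x)" if ne: "\<sigma> \<noteq> {}" "\<sigma> \<subseteq> {1..m}" for \<sigma>
  proof -
    obtain r where "0 < r" "\<sigma> \<in> indexed_cech r" using eventually_indexed_cech [OF ne] .
    then have "\<sigma> \<in> indexed_cech (2 powr (log 2 r))" by simp
    then show ?thesis ..
  qed
qed

lemma capped_indexed_interleaved:
  shows "capped_cech (2 powr x) \<subseteq> indexed_cech (2 powr x)"
    "indexed_cech (2 powr x) \<subseteq> capped_cech (2 powr (x + log 2 (1 + \<epsilon>)))"
  using capped_cech_subset [of "2 powr x"] indexed_cech_subset [of "2 powr x"] eps
  by (simp_all add: powr_add)

lemma filtered_complex_capped_cech: "filtered_complex m (\<lambda>x. capped_cech (2 powr x))"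
  unfolding filtered_complex_def
proof (intro conjI allI impI)
  show "finite_complex (capped_cech (2 powr x))" for x
    unfolding capped_cech_def by (rule finite_complex_nerve) simp
  show "capped_cech (2 powr x) \<subseteq> Pow {1..m}" for x
    by (auto simp: capped_cech_def nerve_def)
  show "capped_cech (2 powr x) \<subseteq> capped_cech (2 powr y)" if "x \<le> y" for x y
    using that by (intro capped_cech_mono) simp
  show "\<sigma> \<in> capped_cech (2 powr x)" if later: "\<forall>y>x. \<sigma> \<in> capped_cech (2 powr y)" for x \<sigma>
  proof (rule capped_cech_right_closed)
    fix s assume s: "2 powr x < s"
    have "0 < s" using s powr_ge_zero [of 2 x] by linarith
    moreover from this s have "x < log 2 s" by (simp add: less_log_iff)
    ultimately show "\<sigma> \<in> capped_cech s" using later [rule_format, of "log 2 s"] by simp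
  qed
  show "\<exists>x. \<sigma> \<in> capped_cech (2 powr x)" if "\<sigma> \<noteq> {}" "\<sigma> \<subseteq> {1..m}" for \<sigma>
    using filtered_complexD(5) [OF filtered_complex_indexed_cech that] capped_indexed_interleaved(2) by blast
qed

lemma relabel_indexed_cech:
  "natural_map (realization_rspace (\<lambda>x. indexed_cech (2 powr x)))
     (realization_rspace (\<lambda>x. cech p P (2 powr x))) (\<lambda>x. relabel {1..m} pt)"
  "homotopy_equivalence_map (realization (indexed_cech (2 powr x)))
     (realization (cech p P (2 powr x))) (relabel {1..m} pt)"
proof -
  have hom: "homeomorphic_map (realization (indexed_cech (2 powr x)))
     (realization (cech p P (2 powr x))) (relabel {1..m} pt)" for x
    unfolding cech_eq_indexed
    using filtered_complexD(1,2) [OF filtered_complex_indexed_cech, of x]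
    by (intro homeomorphic_map_relabel bij_betw_imp_inj_on [OF pt_bij]) (auto simp: finite_complex_def)
  then show "homotopy_equivalence_map (realization (indexed_cech (2 powr x)))
     (realization (cech p P (2 powr x))) (relabel {1..m} pt)"
    by (rule homotopy_equivalence_map_homeomorphic)
  show "natural_map (realization_rspace (\<lambda>x. indexed_cech (2 powr x)))
     (realization_rspace (\<lambda>x. cech p P (2 powr x))) (\<lambda>x. relabel {1..m} pt)"
    using homeomorphic_imp_continuous_map [OF hom] by (simp add: natural_map_def realization_rspace_def)
qed

lemma sparse_to_capped_cech:
  fixes X :: "'u rspace"
  assumes "rspace_isomorphic X (realization_rspace (\<lambda>x. sparse_filtration p \<epsilon> m pt (2 powr x)))"
  obtains f where "natural_map X (realization_rspace (\<lambda>x. capped_cech (2 powr x))) f"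
    "\<And>x. homotopy_equivalence_map (obj X x) (realization (capped_cech (2 powr x))) (f x)"
proof -
  obtain f where f: "natural_map X (realization_rspace (\<lambda>x. sparse_filtration p \<epsilon> m pt (2 powr x))) f"
      "\<And>x. homeomorphic_map (obj X x) (realization (sparse_filtration p \<epsilon> m pt (2 powr x))) (f x)"
    using assms unfolding rspace_isomorphic_def by (auto simp: realization_rspace_def)
  have he: "homotopy_equivalence_map (obj X x) (realization (capped_cech (2 powr x))) (f x)" for x
    using homotopy_equivalence_map_compose [OF homotopy_equivalence_map_homeomorphic [OF f(2)]
        sparse_inclusion_homotopy_equivalence] by (simp add: o_def)
  then have "natural_map X (realization_rspace (\<lambda>x. capped_cech (2 powr x))) f"
    using f(1) by (simp add: natural_map_def realization_rspace_def homotopy_equivalence_map_def)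
  with he show ?thesis using that by blast
qed

lemma capped_cech_trivial: "m \<le> 1 \<Longrightarrow> capped_cech r = indexed_cech r"
  unfolding capped_cech_def indexed_cech_def by (rule nerve_cong) (auto simp: capped_radius_def)

end

theorem theorem6p11:
  fixes p :: ereal and \<epsilon> :: real
    and P :: "(real ^ 'n) set" and m :: nat and pt :: "nat \<Rightarrow> real ^ 'n"
    and d :: "'u rspace \<Rightarrow> 'u rspace \<Rightarrow> ennreal"
    and X Y :: "'u rspace"
  assumes "1 \<le> p" and "0 < \<epsilon>" and "\<epsilon> < 1"
    and "finite P" and "greedy_permutation p P m pt"
    and "rspace_distance d" and "stable_distance d" and "homotopy_invariant_distance d"
    and "is_rspace X"
    and "rspace_isomorphic X (realization_rspace (\<lambda>x. sparse_filtration p \<epsilon> m pt (2 powr x)))"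
    and "is_rspace Y"
    and "rspace_isomorphic Y (realization_rspace (\<lambda>x. cech p P (2 powr x)))"
  shows "d X Y \<le> ennreal (log 2 (1 + \<epsilon>))"
proof -
  interpret greedy_sparsification p \<epsilon> P m pt
    using assms by unfold_locales
  let ?E = "\<lambda>x. capped_cech (2 powr x)" and ?C = "\<lambda>x. indexed_cech (2 powr x)"
  let ?Q = "realization_rspace (\<lambda>x. cech p P (2 powr x))" and ?\<delta> = "log 2 (1 + \<epsilon>)"
  obtain f where f: "natural_map X (realization_rspace ?E) f"
      "\<And>x. homotopy_equivalence_map (obj X x) (realization (?E x)) (f x)"
    using sparse_to_capped_cech assms by blast
  have obj_cech: "obj ?Q x = realization (cech p P (2 powr x))" for x
    by (simp add: realization_rspace_def)
  have natural_relabel: "natural_map R ?Q (\<lambda>x. relabel {1..m} pt \<circ> h x)"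
    if "natural_map R (realization_rspace ?C) h" for R :: "'u rspace" and h
    using that relabel_indexed_cech(1)
    by (auto simp: natural_map_def realization_rspace_def intro: continuous_map_compose)
  show ?thesis
  proof (cases "m \<le> 1")
    \<comment> \<open>With at most one point no ball ever freezes. The universe may be too small for
      a cylinder, but \<open>X\<close> maps to \<open>Y\<close> by a weak equivalence and their
      distance is 0.\<close>
    case True
    then have EC: "?E = ?C" using capped_cech_trivial by simp
    have "weakly_equivalent_step X Y"
    proof (rule weakly_equivalent_step_via_isomorphic [OF assms(9,11) natural_relabel])
      show "natural_map X (realization_rspace ?C) f" using f(1) unfolding EC .
      show "homotopy_equivalence_map (obj X x) (obj ?Q x) (relabel {1..m} pt \<circ> f x)" for x
        unfolding obj_cech
        by (rule homotopy_equivalence_map_compose [OF f(2) [unfolded fun_cong [OF EC]] relabel_indexed_cech(2)])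
    qed (rule assms(12))
    then show ?thesis
      using homotopy_invariant_distance_step [OF assms(8)] by simp
  next
    case False
    \<comment> \<open>The first two points eventually span an edge of the Cech complex; the
      isomorphism from \<open>Y\<close> brings this edge back into the universe.\<close>
    have "\<exists>\<phi> :: real \<Rightarrow> 'u. inj_on \<phi> {0..1}"
    proof -
      have "{1, 2} \<noteq> ({} :: nat set)" "{1, 2} \<subseteq> {1..m}" using False by auto
      from filtered_complexD(5) [OF filtered_complex_indexed_cech this]
      obtain x where x: "{1, 2} \<in> ?C x" by blast
      have pt12: "pt 1 \<noteq> pt 2"
        using False inj_onD [OF bij_betw_imp_inj_on [OF pt_bij], of 1 2] by auto
      have edge: "{pt 1, pt 2} \<in> cech p P (2 powr x)"
        using imageI [OF x, of "(`) pt"] by (simp add: cech_eq_indexed)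
      have "finite (cech p P (2 powr x))"
        using filtered_complexD(1) [OF filtered_complex_indexed_cech, of x]
        by (simp add: cech_eq_indexed finite_complex_def)
      then have "topspace (obj ?Q x) = geometric_carrier (cech p P (2 powr x))"
        unfolding obj_cech by (simp add: realization_finite)
      then have sub: "closed_simplex {pt 1, pt 2} \<subseteq> topspace (obj ?Q x)"
        using UN_upper [OF edge, of closed_simplex] by (simp add: geometric_carrier_def)
      obtain h where "homeomorphic_map (obj Y x) (obj ?Q x) h"
        using assms unfolding rspace_isomorphic_def by blast
      then obtain g where g: "homeomorphic_maps (obj Y x) (obj ?Q x) h g"
        using homeomorphic_map_maps by blast
      have "inj_on g (topspace (obj ?Q x))"
        using g unfolding homeomorphic_maps_def by (intro inj_on_inverseI [of _ h]) simp
      then have "inj_on (g \<circ> (\<lambda>s v. if v = pt 1 then s else if v = pt 2 then 1 - s else 0)) {0..1}"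
        by (intro comp_inj_on inj_on_edge(1) [OF pt12] inj_on_subset [OF _ order_trans [OF inj_on_edge(2) [OF pt12] sub]])
      then show ?thesis by blast
    qed
    then obtain e :: "(nat \<Rightarrow> real) \<times> real \<Rightarrow> 'u" where "inj e" using inj_cylinder by blast
    then interpret embedded_cylinder m e
      by unfold_locales (auto intro: inj_on_subset)
    note E = filtered_complex_capped_cech and C = filtered_complex_indexed_cech
    \<comment> \<open>\<open>?R\<close> is the capped filtration inside the universe. The chain is
      \<open>X\<close> to \<open>?R\<close>, \<open>?SE\<close> to \<open>?R\<close>, and
      \<open>?SC\<close> to \<open>Y\<close>, all weak equivalences, with stability bridging
      \<open>?SE\<close> and \<open>?SC\<close>.\<close>
    let ?R = "slab ?E (\<lambda>_. {0})" and ?SE = "slab ?E (\<lambda>x. {..x})" and ?SC = "slab ?C (\<lambda>x. {..x})"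
    have rsp: "is_rspace ?R" "is_rspace ?SE" "is_rspace ?SC"
      by (auto intro: is_rspace_slab E C)
    have XR: "weakly_equivalent_step X ?R"
      by (rule weakly_equivalent_step_via_isomorphic [OF assms(9) rsp(1) f(1) _ isomorphic_slab [OF E]])
        (simp add: realization_rspace_def f(2))
    have SER: "weakly_equivalent_step ?SE ?R"
    proof (rule weakly_equivalent_step_via_isomorphic [OF rsp(2,1) _ _ isomorphic_slab [OF E]])
      show "natural_map ?SE (realization_rspace ?E) (\<lambda>x. fst \<circ> pos)"
        by (rule natural_map_slab [OF E]) auto
      show "homotopy_equivalence_map (obj ?SE x) (obj (realization_rspace ?E) x) (fst \<circ> pos)" for x
        using homotopy_equivalence_slab [OF E, of "\<lambda>x. {..x}" x x] by (simp add: realization_rspace_def)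
    qed
    have SCY: "weakly_equivalent_step ?SC Y"
    proof (rule weakly_equivalent_step_via_isomorphic [OF rsp(3) _ natural_relabel])
      show "natural_map ?SC (realization_rspace ?C) (\<lambda>x. fst \<circ> pos)"
        by (rule natural_map_slab [OF C]) auto
      show "homotopy_equivalence_map (obj ?SC x) (obj ?Q x) (relabel {1..m} pt \<circ> (fst \<circ> pos))" for x
        unfolding obj_cech
        by (rule homotopy_equivalence_map_compose [OF homotopy_equivalence_slab [OF C, of _ x x] relabel_indexed_cech(2)]) auto
    qed (use assms in auto)
    have "d ?SE ?SC \<le> (SUP u\<in>topspace ambient. ennreal \<bar>(entry_time ?E \<circ> pos) u - (entry_time ?C \<circ> pos) u\<bar>)"
      unfolding sublevel_eq_slab [OF E, symmetric] sublevel_eq_slab [OF C, symmetric]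
      by (rule assms(7) [unfolded stable_distance_def, rule_format, OF cgwh_ambient])
    also have "\<dots> \<le> ennreal ?\<delta>"
    proof (intro SUP_least ennreal_leI)
      fix u assume "u \<in> topspace ambient"
      then have "fst (pos u) \<in> closed_simplex {1..m}" by (auto simp: topspace_ambient pos_e)
      then show "\<bar>(entry_time ?E \<circ> pos) u - (entry_time ?C \<circ> pos) u\<bar> \<le> ?\<delta>"
        unfolding comp_apply using assms(2)
        by (intro entry_time_interleaved [OF E C] capped_indexed_interleaved) auto
    qed
    finally have close: "d ?SE ?SC \<le> ennreal ?\<delta>" .
    have tri: "d A D \<le> d A B + d B D" if "is_rspace A" "is_rspace B" "is_rspace D" for A B D
      using assms(6) that unfolding rspace_distance_def by blast
    \<comment> \<open>Along the chain only the summand between the two sublevel filtrations can be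
      nonzero.\<close>
    have "d X Y \<le> d X ?R + d ?R Y" using tri assms rsp by blast
    also have "d ?R Y \<le> d ?R ?SE + d ?SE Y" using tri assms rsp by blast
    also have "d ?SE Y \<le> d ?SE ?SC + d ?SC Y" using tri assms rsp by blast
    finally have "d X Y \<le> d X ?R + (d ?R ?SE + (d ?SE ?SC + d ?SC Y))"
      by (simp add: add_left_mono)
    then show ?thesis
      using homotopy_invariant_distance_step [OF assms(8) XR] homotopy_invariant_distance_step [OF assms(8) SER]
        homotopy_invariant_distance_step [OF assms(8) SCY] close by simp
  qed
qed

end
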